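(* Let $A$ be a $\Bbbk$-algebra, let $n\geq 1$ be an integer, and let $\{\!\{-,-\}\!\}:A\times A\to A\otimes A$ be a double Poisson bracket associated with the inner bimodule structure. Then the unique antisymmetric biderivation $\{-,-\}$ on $\Bbbk[\operatorname{Rep}(A,n)]$ satisfying $$\{a_{ij},b_{kl}\}=\{\!\{a,b\}\!\}'_{il}\,\{\!\{a,b\}\!\}''_{kj}\,,\qquad a,b\in A,\ 1\leq i,j,k,l\leq n,$$ is a Poisson bracket. Furthermore, this Poisson bracket descends (i.e. restricts) to the ring of trace functions $\Bbbk[\operatorname{Rep}(A,n)]^{\operatorname{tr}}$.
   Context: $\Bbbk$ is a field of characteristic $0$, $\otimes=\otimes_\Bbbk$, and all algebras are unital, associative, finitely generated $\Bbbk$-algebras. An element $d\in A\otimes A$ is written $d=d'\otimes d''$ (Sweedler notation, sum suppressed), and $d^\circ=d''\otimes d'$. The symmetric group $S_m$ acts on $A^{\otimes m}$ by $\tau_\sigma(a_1\otimes\cdots\otimes a_m)=a_{\sigma^{-1}(1)}\otimes\cdots\otimes a_{\sigma^{-1}(m)}$. A double bracket on $A$ associated with the inner bimodule structure is a $\Bbbk$-bilinear map $\{\!\{-,-\}\!\}:A\times A\to A\otimes A$ such that for all $a,b,c\in A$: $\{\!\{a,b\}\!\}=-\{\!\{b,a\}\!\}^\circ$; $\{\!\{a,bc\}\!\}=\{\!\{a,c\}\!\}'\otimes b\{\!\{a,c\}\!\}''+\{\!\{a,b\}\!\}'c\otimes\{\!\{a,b\}\!\}''$; $\{\!\{bc,a\}\!\}=b\{\!\{c,a\}\!\}'\otimes\{\!\{c,a\}\!\}''+\{\!\{b,a\}\!\}'\otimes\{\!\{b,a\}\!\}''c$.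 Put $\{\!\{a,b_1\otimes b_2\}\!\}_L=\{\!\{a,b_1\}\!\}\otimes b_2\in A^{\otimes 3}$ (extended linearly). The double Jacobiator is $\{\!\{a,b,c\}\!\}=\{\!\{a,\{\!\{b,c\}\!\}\}\!\}_L+\tau_{(123)}\{\!\{b,\{\!\{c,a\}\!\}\}\!\}_L+\tau_{(132)}\{\!\{c,\{\!\{a,b\}\!\}\}\!\}_L$. The double bracket is Poisson if its double Jacobiator vanishes identically. $\Bbbk[\operatorname{Rep}(A,n)]$ is the commutative $\Bbbk$-algebra generated by symbols $a_{ij}$ ($a\in A$, $1\leq i,j\leq n$) subject to $\lambda a_{ij}+\mu b_{ij}=(\lambda a+\mu b)_{ij}$, $1_{ij}=\delta_{ij}$, $(ab)_{ij}=\sum_{k=1}^n a_{ik}b_{kj}$ for $a,b\in A$, $\lambda,\mu\in\Bbbk$. For $a \in A$, $\mathtt{X}(a)=(a_{ij})_{i,j}$ is the matrix with entries $a_{ij}$, and $\Bbbk[\operatorname{Rep}(A,n)]^{\operatorname{tr}}$ is the subalgebra generated by $\operatorname{tr}\mathtt{X}(a)=\sum_i a_{ii}$, $a\in A$. It is known that the antisymmetric biderivation in the statement exists and is unique for any double bracket associated with the inner bimodule structure. *)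

theory Defs
  imports
    Complex_Main
    "HOL-Library.Poly_Mapping"
    "HOL-Combinatorics.Cycles"
    "HOL-Algebra.QuotRing"
    "HOL-Algebra.Module"
begin

(* The ground field and the algebra A are types; the sort of A does not include 0 \<noteq> 1, so the
   zero algebra is allowed.  Everything constructed from A (tensor powers, the representation
   algebra) is a quotient depending on the scalar action, hence a HOL-Algebra record whose
   elements are cosets. *)

locale k_algebra = vector_space scale
  for scale :: "'k::field_char_0 \<Rightarrow> 'a::{ring, monoid_mult} \<Rightarrow> 'a" +
  assumes scale_mult_left: "scale c (x * y) = scale c x * y"
    and scale_mult_right: "scale c (x * y) = x * scale c y"

definition type_algebra :: "('k \<Rightarrow> 'a \<Rightarrow> 'a) \<Rightarrow> ('k, 'a::{ring, monoid_mult}) module" where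
  "type_algebra scale =
    \<lparr>carrier = UNIV, monoid.mult = (*), one = 1, zero = 0, add = (+), smult = scale\<rparr>"

inductive_set generated_subalgebra :: "('k, 'r, 'm) module_scheme \<Rightarrow> 'r set \<Rightarrow> 'r set"
  for R (structure) and S where
  one: "\<one> \<in> generated_subalgebra R S"
| gen: "s \<in> S \<Longrightarrow> s \<in> generated_subalgebra R S"
| add: "x \<in> generated_subalgebra R S \<Longrightarrow> y \<in> generated_subalgebra R S
    \<Longrightarrow> x \<oplus> y \<in> generated_subalgebra R S"
| mult: "x \<in> generated_subalgebra R S \<Longrightarrow> y \<in> generated_subalgebra R S
    \<Longrightarrow> x \<otimes> y \<in> generated_subalgebra R S"
| smult: "x \<in> generated_subalgebra R S \<Longrightarrow> c \<odot> x \<in> generated_subalgebra R S"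

definition finitely_generated_algebra :: "('k \<Rightarrow> 'a::{ring, monoid_mult} \<Rightarrow> 'a) \<Rightarrow> bool" where
  "finitely_generated_algebra scale \<longleftrightarrow>
    (\<exists>S. finite S \<and> generated_subalgebra (type_algebra scale) S = UNIV)"

definition coset_smult ::
    "('k, 'r, 'm) module_scheme \<Rightarrow> 'r set \<Rightarrow> 'k \<Rightarrow> 'r set \<Rightarrow> 'r set" where
  "coset_smult M W c C = (\<Union>x\<in>C. W +>\<^bsub>M\<^esub> (c \<odot>\<^bsub>M\<^esub> x))"


section \<open>Tensor powers of A\<close>

(* The m-th tensor power is the free vector space on the lists of length m (a_1,...,a_m),
   modulo the span of the multilinearity relations in each slot.  The multiplicative fields
   of the records are irrelevant and left undefined. *)

definition formal_scale :: "'k::field \<Rightarrow> ('b \<Rightarrow>\<^sub>0 'k) \<Rightarrow> ('b \<Rightarrow>\<^sub>0 'k)" where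
  "formal_scale c p = Poly_Mapping.map (\<lambda>x. c * x) p"

definition free_lists :: "nat \<Rightarrow> ('k::field, 'a list \<Rightarrow>\<^sub>0 'k) module" where
  "free_lists m =
    \<lparr>carrier = {p. Poly_Mapping.keys p \<subseteq> {xs. length xs = m}},
     monoid.mult = undefined, one = undefined, zero = 0, add = (+), smult = formal_scale\<rparr>"

definition tensor_relations ::
    "('k::field \<Rightarrow> 'a::ab_group_add \<Rightarrow> 'a) \<Rightarrow> nat \<Rightarrow> ('a list \<Rightarrow>\<^sub>0 'k) set" where
  "tensor_relations scale m = Modules.module.span formal_scale
    ({Poly_Mapping.single (xs[i := x + y]) 1
        - Poly_Mapping.single (xs[i := x]) 1 - Poly_Mapping.single (xs[i := y]) 1
      | xs i x y. length xs = m \<and> i < m}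
     \<union> {Poly_Mapping.single (xs[i := scale c x]) 1 - Poly_Mapping.single (xs[i := x]) c
      | xs i c x. length xs = m \<and> i < m})"

definition tensor_power ::
    "('k::field \<Rightarrow> 'a::ab_group_add \<Rightarrow> 'a) \<Rightarrow> nat \<Rightarrow> ('k, ('a list \<Rightarrow>\<^sub>0 'k) set) module" where
  "tensor_power scale m =
    (let F = free_lists m; W = tensor_relations scale m
     in \<lparr>carrier = a_rcosets\<^bsub>F\<^esub> W, monoid.mult = undefined, one = undefined,
         zero = W, add = set_add F, smult = coset_smult F W\<rparr>)"

definition pure_tensor ::
    "('k::field \<Rightarrow> 'a::ab_group_add \<Rightarrow> 'a) \<Rightarrow> 'a list \<Rightarrow> ('a list \<Rightarrow>\<^sub>0 'k) set" where
  "pure_tensor scale xs =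
    tensor_relations scale (length xs) +>\<^bsub>free_lists (length xs)\<^esub> Poly_Mapping.single xs 1"

(* Linear extension to the tensor power of a multilinear map f (a function of the list of
   arguments) into M; for multilinear f the value does not depend on the chosen representative
   of t.  Sweedler expressions in d = d' \<otimes> d'' are written with d' = xs ! 0, d'' = xs ! 1. *)
definition tensor_lift ::
    "('k::field, 'r, 'm) module_scheme \<Rightarrow> ('a list \<Rightarrow> 'r) \<Rightarrow> ('a list \<Rightarrow>\<^sub>0 'k) set \<Rightarrow> 'r" where
  "tensor_lift M f t =
    (let p = (SOME p. p \<in> t)
     in finsum M (\<lambda>xs. Poly_Mapping.lookup p xs \<odot>\<^bsub>M\<^esub> f xs) (Poly_Mapping.keys p))"

(* Permutations act on the positions 1,...,m, whereas list positions start at 0. *)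
definition tensor_perm ::
    "('k::field \<Rightarrow> 'a::ab_group_add \<Rightarrow> 'a) \<Rightarrow> nat \<Rightarrow> (nat \<Rightarrow> nat)
      \<Rightarrow> ('a list \<Rightarrow>\<^sub>0 'k) set \<Rightarrow> ('a list \<Rightarrow>\<^sub>0 'k) set" where
  "tensor_perm scale m \<sigma> = tensor_lift (tensor_power scale m)
    (\<lambda>xs. pure_tensor scale (map (\<lambda>i. xs ! (inv_into UNIV \<sigma> i - 1)) [1..<Suc m]))"


section \<open>Double Poisson brackets\<close>

definition tensor_flip ::
    "('k::field \<Rightarrow> 'a::ab_group_add \<Rightarrow> 'a) \<Rightarrow> ('a list \<Rightarrow>\<^sub>0 'k) set \<Rightarrow> ('a list \<Rightarrow>\<^sub>0 'k) set" where
  "tensor_flip scale =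
    tensor_lift (tensor_power scale 2) (\<lambda>xs. pure_tensor scale [xs ! 1, xs ! 0])"

definition double_bracket ::
    "('k::field_char_0 \<Rightarrow> 'a::{ring, monoid_mult} \<Rightarrow> 'a)
      \<Rightarrow> ('a \<Rightarrow> 'a \<Rightarrow> ('a list \<Rightarrow>\<^sub>0 'k) set) \<Rightarrow> bool" where
  "double_bracket scale dbr \<longleftrightarrow>
    (let T = tensor_power scale 2; L = tensor_lift T; p = pure_tensor scale in
      (\<forall>a b. dbr a b \<in> carrier T) \<and>
      (\<forall>a b c. dbr (a + b) c = dbr a c \<oplus>\<^bsub>T\<^esub> dbr b c) \<and>
      (\<forall>a b c. dbr a (b + c) = dbr a b \<oplus>\<^bsub>T\<^esub> dbr a c) \<and>
      (\<forall>r a b. dbr (scale r a) b = r \<odot>\<^bsub>T\<^esub> dbr a b) \<and>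
      (\<forall>r a b. dbr a (scale r b) = r \<odot>\<^bsub>T\<^esub> dbr a b) \<and>
      (\<forall>a b. dbr a b = \<ominus>\<^bsub>T\<^esub> tensor_flip scale (dbr b a)) \<and>
      (\<forall>a b c. dbr a (b * c) =
        L (\<lambda>xs. p [xs ! 0, b * xs ! 1]) (dbr a c) \<oplus>\<^bsub>T\<^esub> L (\<lambda>xs. p [xs ! 0 * c, xs ! 1]) (dbr a b)) \<and>
      (\<forall>a b c. dbr (b * c) a =
        L (\<lambda>xs. p [b * xs ! 0, xs ! 1]) (dbr c a) \<oplus>\<^bsub>T\<^esub> L (\<lambda>xs. p [xs ! 0, xs ! 1 * c]) (dbr b a)))"

definition double_bracket_L ::
    "('k::field \<Rightarrow> 'a::ab_group_add \<Rightarrow> 'a) \<Rightarrow> ('a \<Rightarrow> 'a \<Rightarrow> ('a list \<Rightarrow>\<^sub>0 'k) set)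
      \<Rightarrow> 'a \<Rightarrow> ('a list \<Rightarrow>\<^sub>0 'k) set \<Rightarrow> ('a list \<Rightarrow>\<^sub>0 'k) set" where
  "double_bracket_L scale dbr a =
    tensor_lift (tensor_power scale 3)
      (\<lambda>bs. tensor_lift (tensor_power scale 3)
        (\<lambda>xs. pure_tensor scale [xs ! 0, xs ! 1, bs ! 1]) (dbr a (bs ! 0)))"

definition double_jacobiator ::
    "('k::field \<Rightarrow> 'a::ab_group_add \<Rightarrow> 'a) \<Rightarrow> ('a \<Rightarrow> 'a \<Rightarrow> ('a list \<Rightarrow>\<^sub>0 'k) set)
      \<Rightarrow> 'a \<Rightarrow> 'a \<Rightarrow> 'a \<Rightarrow> ('a list \<Rightarrow>\<^sub>0 'k) set" where
  "double_jacobiator scale dbr a b c =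
    (let T = tensor_power scale 3; D = double_bracket_L scale dbr in
      D a (dbr b c)
      \<oplus>\<^bsub>T\<^esub> tensor_perm scale 3 (cycle_of_list [1, 2, 3]) (D b (dbr c a))
      \<oplus>\<^bsub>T\<^esub> tensor_perm scale 3 (cycle_of_list [1, 3, 2]) (D c (dbr a b)))"

definition double_poisson_bracket ::
    "('k::field_char_0 \<Rightarrow> 'a::{ring, monoid_mult} \<Rightarrow> 'a)
      \<Rightarrow> ('a \<Rightarrow> 'a \<Rightarrow> ('a list \<Rightarrow>\<^sub>0 'k) set) \<Rightarrow> bool" where
  "double_poisson_bracket scale dbr \<longleftrightarrow>
    double_bracket scale dbr \<and>
    (\<forall>a b c. double_jacobiator scale dbr a b c = \<zero>\<^bsub>tensor_power scale 3\<^esub>)"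


section \<open>The representation algebra\<close>

(* The polynomial algebra in the variables a_ij (a in A, i and j in the finite index type 'n of
   size n) modulo the ideal generated by the defining relations. *)

type_synonym ('k, 'a, 'n) rep_poly = "(('a \<times> 'n \<times> 'n) \<Rightarrow>\<^sub>0 nat) \<Rightarrow>\<^sub>0 'k"

definition poly_const :: "'k::field \<Rightarrow> ('k, 'a, 'n) rep_poly" where
  "poly_const c = Poly_Mapping.single 0 c"

definition poly_var :: "'a \<Rightarrow> 'n \<Rightarrow> 'n \<Rightarrow> ('k::field, 'a, 'n) rep_poly" where
  "poly_var a i j = Poly_Mapping.single (Poly_Mapping.single (a, i, j) 1) 1"

definition rep_poly_algebra :: "('k::field, ('k, 'a, 'n) rep_poly) module" where
  "rep_poly_algebra = type_algebra (\<lambda>c f. poly_const c * f)"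

definition rep_ideal ::
    "('k::field \<Rightarrow> 'a::{ring, monoid_mult} \<Rightarrow> 'a) \<Rightarrow> ('k, 'a, 'n::finite) rep_poly set" where
  "rep_ideal scale = genideal rep_poly_algebra
    ({poly_const r * poly_var a i j + poly_const s * poly_var b i j
        - poly_var (scale r a + scale s b) i j | r s a b i j. True}
     \<union> {poly_var 1 i j - (if i = j then 1 else 0) | i j. True}
     \<union> {poly_var (a * b) i j - (\<Sum>k\<in>UNIV. poly_var a i k * poly_var b k j) | a b i j. True})"

definition rep_algebra ::
    "('k::field \<Rightarrow> 'a::{ring, monoid_mult} \<Rightarrow> 'a)
      \<Rightarrow> ('k, ('k, 'a, 'n::finite) rep_poly set) module" where
  "rep_algebra scale =
    ring.extend (rep_poly_algebra Quot rep_ideal scale)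
      \<lparr>smult = coset_smult rep_poly_algebra (rep_ideal scale)\<rparr>"

definition rep_coord ::
    "('k::field \<Rightarrow> 'a::{ring, monoid_mult} \<Rightarrow> 'a) \<Rightarrow> 'a \<Rightarrow> 'n::finite \<Rightarrow> 'n
      \<Rightarrow> ('k, 'a, 'n) rep_poly set" where
  "rep_coord scale a i j = rep_ideal scale +>\<^bsub>rep_poly_algebra\<^esub> poly_var a i j"

definition rep_trace ::
    "('k::field \<Rightarrow> 'a::{ring, monoid_mult} \<Rightarrow> 'a) \<Rightarrow> 'a \<Rightarrow> ('k, 'a, 'n::finite) rep_poly set" where
  "rep_trace scale a = finsum (rep_algebra scale) (\<lambda>i. rep_coord scale a i i) UNIV"

definition trace_algebra ::
    "('k::field \<Rightarrow> 'a::{ring, monoid_mult} \<Rightarrow> 'a)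
      \<Rightarrow> ('k, ('k, 'a, 'n::finite) rep_poly set) module" where
  "trace_algebra scale =
    (rep_algebra scale)
      \<lparr>carrier := generated_subalgebra (rep_algebra scale) (range (rep_trace scale))\<rparr>"


section \<open>Poisson brackets\<close>

definition antisymmetric_biderivation ::
    "('k, 'r, 'm) module_scheme \<Rightarrow> ('r \<Rightarrow> 'r \<Rightarrow> 'r) \<Rightarrow> bool" where
  "antisymmetric_biderivation R br \<longleftrightarrow>
    br \<in> carrier R \<rightarrow> carrier R \<rightarrow> carrier R \<and>
    (\<forall>f\<in>carrier R. \<forall>g\<in>carrier R. \<forall>h\<in>carrier R.
      br (f \<oplus>\<^bsub>R\<^esub> g) h = br f h \<oplus>\<^bsub>R\<^esub> br g h \<and>
      br f (g \<oplus>\<^bsub>R\<^esub> h) = br f g \<oplus>\<^bsub>R\<^esub> br f h \<and>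
      (\<forall>c. br (c \<odot>\<^bsub>R\<^esub> f) g = c \<odot>\<^bsub>R\<^esub> br f g) \<and>
      (\<forall>c. br f (c \<odot>\<^bsub>R\<^esub> g) = c \<odot>\<^bsub>R\<^esub> br f g) \<and>
      br f g = \<ominus>\<^bsub>R\<^esub> br g f \<and>
      br (f \<otimes>\<^bsub>R\<^esub> g) h = f \<otimes>\<^bsub>R\<^esub> br g h \<oplus>\<^bsub>R\<^esub> br f h \<otimes>\<^bsub>R\<^esub> g \<and>
      br f (g \<otimes>\<^bsub>R\<^esub> h) = g \<otimes>\<^bsub>R\<^esub> br f h \<oplus>\<^bsub>R\<^esub> br f g \<otimes>\<^bsub>R\<^esub> h)"

definition poisson_bracket ::
    "('k, 'r, 'm) module_scheme \<Rightarrow> ('r \<Rightarrow> 'r \<Rightarrow> 'r) \<Rightarrow> bool" where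
  "poisson_bracket R br \<longleftrightarrow>
    antisymmetric_biderivation R br \<and>
    (\<forall>f\<in>carrier R. \<forall>g\<in>carrier R. \<forall>h\<in>carrier R.
      br f (br g h) \<oplus>\<^bsub>R\<^esub> br g (br h f) \<oplus>\<^bsub>R\<^esub> br h (br f g) = \<zero>\<^bsub>R\<^esub>)"

(* Extensionality (br = undefined off the carrier) is imposed only so that the uniqueness of
   br can be expressed as an equality of functions. *)
definition induced_biderivation ::
    "('k::field_char_0 \<Rightarrow> 'a::{ring, monoid_mult} \<Rightarrow> 'a)
      \<Rightarrow> ('a \<Rightarrow> 'a \<Rightarrow> ('a list \<Rightarrow>\<^sub>0 'k) set)
      \<Rightarrow> (('k, 'a, 'n::finite) rep_poly set \<Rightarrow> ('k, 'a, 'n) rep_poly set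
          \<Rightarrow> ('k, 'a, 'n) rep_poly set) \<Rightarrow> bool" where
  "induced_biderivation scale dbr br \<longleftrightarrow>
    (let R = rep_algebra scale; x = rep_coord scale in
      br \<in> carrier R \<rightarrow>\<^sub>E carrier R \<rightarrow>\<^sub>E carrier R \<and>
      antisymmetric_biderivation R br \<and>
      (\<forall>a b i j k l. br (x a i j) (x b k l) =
        tensor_lift R (\<lambda>xs. x (xs ! 0) i l \<otimes>\<^bsub>R\<^esub> x (xs ! 1) k j) (dbr a b)))"

end

theory Submission
  imports Defs
begin

text \<open>
The formula $\{a_{ij},b_{kl}\} = d'_{il}\,d''_{kj}$, with $d = d' \otimes d''$ the double bracket of
$a$ and $b$, prescribes the bracket of two generators.  On the polynomial algebra in the symbols
$a_{ij}$ such values always extend to a biderivation, by the Leibniz rule in each argument.  Three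
facts make this biderivation descend to the representation algebra and be Poisson there, and each
has to be checked on generators only, because the failure of the corresponding identity is a
derivation modulo the ideal in every argument, and such a derivation vanishes modulo the ideal as
soon as it does so on the variables (\<open>derivation_mod_vanishes\<close>).

\<^item> Antisymmetry is the antisymmetry of the double bracket under exchange of the two tensor factors
  (\<open>evaluate_2_antisym\<close>).

\<^item> The bracket with a variable maps the defining relations into the ideal
  (\<open>coord_bracket_relations\<close>): linearity of the double bracket deals with the linear relations, the
  two summands of its Leibniz rule are exactly the two summands of the Leibniz rule for
  $\sum_p b_{kp}c_{pl}$, and the Leibniz rule for $1 \cdot 1$ shows that the bracket with $1$ is zero.

\<^item> For the Jacobi identity, expand $\{a_{ij},\{b_{kl},c_{pq}\}\}$ with the Leibniz rule.  Differentiating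
  the first factor gives $x'_{iq}x''_{kj}x'''_{pl}$ at $x = \{\{a,\{\{b,c\}\}\}\}_L$.  Differentiating the second
  factor gives, after rewriting the double bracket of $b$ and $c$ by antisymmetry, minus
  $y'_{il}y''_{pj}y'''_{kq}$ at $y = \{\{a,\{\{c,b\}\}\}\}_L$ (\<open>nested_coord_bracket\<close>).  In the cyclic sum the
  terms of the first kind add up to an evaluation of the double Jacobiator of $a,b,c$, and those of
  the second kind to an evaluation of the double Jacobiator of $a,c,b$; the cyclic permutations of
  the indices match the permutations of the tensor factors.  Both vanish (\<open>rep_bracket_coord\<close>).

Traces are preserved because $\{\mathrm{tr}\,a,\mathrm{tr}\,b\} = \sum_{i,k} d'_{ik}d''_{ki}
= \mathrm{tr}(d'd'')$ is again a trace (\<open>bracket_of_traces\<close>), and a bracket that preserves the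
generators of a subalgebra preserves the subalgebra.

Tensor powers and the representation algebra consist of cosets.  The computations take place on
representatives, that is in free vector spaces and in the polynomial algebra, as congruences modulo
the tensor relations or the ideal; \<open>tensor_lift_class\<close> and \<open>poisson_bracket_presented\<close> carry the
results over to the cosets.
\<close>

section \<open>Linear extension from a basis\<close>

lemma lookup_formal_scale [simp]:
  "Poly_Mapping.lookup (formal_scale c p) x = c * Poly_Mapping.lookup p x"
  unfolding formal_scale_def by transfer (auto simp: when_def)

interpretation formal: vector_space formal_scale
  by unfold_locales (auto intro!: poly_mapping_eqI simp: lookup_add algebra_simps)

lemma formal_scale_single [simp]:
  "formal_scale c (Poly_Mapping.single x r) = Poly_Mapping.single x (c * r)"
  by (rule poly_mapping_eqI) (simp add: lookup_single when_def)

lemma keys_formal_scale: "Poly_Mapping.keys (formal_scale c p) \<subseteq> Poly_Mapping.keys p"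
  by (auto simp: in_keys_iff)

definition lin_ext :: "('k::field \<Rightarrow> 'v::ab_group_add \<Rightarrow> 'v) \<Rightarrow> ('b \<Rightarrow> 'v) \<Rightarrow> ('b \<Rightarrow>\<^sub>0 'k) \<Rightarrow> 'v" where
  "lin_ext s g p = (\<Sum>x\<in>Poly_Mapping.keys p. s (Poly_Mapping.lookup p x) (g x))"

context vector_space
begin

lemma lin_ext_superset:
  assumes "finite A" "Poly_Mapping.keys p \<subseteq> A"
  shows "lin_ext scale g p = (\<Sum>x\<in>A. scale (Poly_Mapping.lookup p x) (g x))"
  unfolding lin_ext_def
  by (rule sum.mono_neutral_left) (use assms in \<open>auto simp: in_keys_iff\<close>)

lemma lin_ext_add: "lin_ext scale g (p + q) = lin_ext scale g p + lin_ext scale g q"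
proof -
  let ?A = "Poly_Mapping.keys p \<union> Poly_Mapping.keys q"
  have "lin_ext scale g (p + q) = (\<Sum>x\<in>?A. scale (Poly_Mapping.lookup (p + q) x) (g x))"
    by (rule lin_ext_superset) (use keys_add[of p q] in auto)
  also have "\<dots> = lin_ext scale g p + lin_ext scale g q"
    by (simp add: lookup_add scale_left_distrib sum.distrib lin_ext_superset[of ?A])
  finally show ?thesis .
qed

lemma lin_ext_scale: "lin_ext scale g (formal_scale c p) = scale c (lin_ext scale g p)"
proof -
  have "lin_ext scale g (formal_scale c p)
      = (\<Sum>x\<in>Poly_Mapping.keys p. scale (Poly_Mapping.lookup (formal_scale c p) x) (g x))"
    by (rule lin_ext_superset) (use keys_formal_scale[of c p] in auto)
  then show ?thesis by (simp add: lin_ext_def scale_sum_right)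
qed

lemma linear_lin_ext: "Vector_Spaces.linear formal_scale scale (lin_ext scale g)"
  by unfold_locales (auto simp: lin_ext_add lin_ext_scale)

lemmas lin_ext_diff = linear_lin_ext[THEN Vector_Spaces.linear.axioms(3), THEN module_hom.diff]
  and lin_ext_sum = linear_lin_ext[THEN Vector_Spaces.linear.axioms(3), THEN module_hom.sum]

lemma lin_ext_single [simp]: "lin_ext scale g (Poly_Mapping.single x c) = scale c (g x)"
  by (simp add: lin_ext_def)

lemma lin_ext_fun_add: "lin_ext scale (\<lambda>x. g x + h x) p = lin_ext scale g p + lin_ext scale h p"
  by (simp add: lin_ext_def scale_right_distrib sum.distrib)

lemma lin_ext_fun_diff: "lin_ext scale (\<lambda>x. g x - h x) p = lin_ext scale g p - lin_ext scale h p"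
  by (simp add: lin_ext_def scale_right_diff_distrib sum_subtractf)

lemma lin_ext_fun_scale: "lin_ext scale (\<lambda>x. scale c (g x)) p = scale c (lin_ext scale g p)"
  by (simp add: lin_ext_def scale_sum_right mult.commute)

lemma lin_ext_fun_sum: "lin_ext scale (\<lambda>x. \<Sum>i\<in>A. g i x) p = (\<Sum>i\<in>A. lin_ext scale (g i) p)"
  unfolding lin_ext_def scale_sum_right by (rule sum.swap)

lemma lin_ext_cong:
  "(\<And>x. x \<in> Poly_Mapping.keys p \<Longrightarrow> g x = h x) \<Longrightarrow> lin_ext scale g p = lin_ext scale h p"
  by (simp add: lin_ext_def)

lemma lin_ext_compose:
  "lin_ext scale h (lin_ext formal_scale g p) = lin_ext scale (\<lambda>x. lin_ext scale h (g x)) p"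
  by (simp add: lin_ext_def[of formal_scale] lin_ext_sum lin_ext_scale)
     (simp add: lin_ext_def)

lemma lin_ext_in_subspace:
  "subspace W \<Longrightarrow> (\<And>x. x \<in> Poly_Mapping.keys p \<Longrightarrow> g x \<in> W) \<Longrightarrow> lin_ext scale g p \<in> W"
  unfolding lin_ext_def by (intro subspace_sum subspace_scale)

end

lemma subspace_keys: "formal.subspace {p. Poly_Mapping.keys p \<subseteq> A}"
proof (rule formal.subspaceI)
  show "x + y \<in> {p. Poly_Mapping.keys p \<subseteq> A}"
    if "x \<in> {p. Poly_Mapping.keys p \<subseteq> A}" "y \<in> {p. Poly_Mapping.keys p \<subseteq> A}" for x y
    using that keys_add[of x y] by blast
  show "formal_scale c x \<in> {p. Poly_Mapping.keys p \<subseteq> A}"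
    if "x \<in> {p. Poly_Mapping.keys p \<subseteq> A}" for c x
    using that keys_formal_scale[of c x] by blast
qed simp

lemma lin_ext_basis: "lin_ext formal_scale (\<lambda>x. Poly_Mapping.single x 1) p = p"
  by (rule poly_mapping_eqI)
     (auto simp: lin_ext_def lookup_sum lookup_single when_def in_keys_iff sum.delta)


section \<open>Multilinear maps and tensor relations\<close>

text \<open>
The maps into a space of cosets are given by representatives of their values, so that they are
multilinear only up to the subspace \<open>W\<close> of relations.
\<close>

definition multilinear_mod ::
    "('k::field \<Rightarrow> 'a::ab_group_add \<Rightarrow> 'a) \<Rightarrow> ('k \<Rightarrow> 'v::ab_group_add \<Rightarrow> 'v) \<Rightarrow> 'v set
      \<Rightarrow> nat \<Rightarrow> ('a list \<Rightarrow> 'v) \<Rightarrow> bool" where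
  "multilinear_mod scale s W m g \<longleftrightarrow>
    (\<forall>xs i x y. length xs = m \<and> i < m \<longrightarrow>
      g (xs[i := x + y]) - g (xs[i := x]) - g (xs[i := y]) \<in> W) \<and>
    (\<forall>xs i c x. length xs = m \<and> i < m \<longrightarrow>
      g (xs[i := scale c x]) - s c (g (xs[i := x])) \<in> W)"

lemma multilinear_mod_2_iff:
  fixes scale :: "'k::field \<Rightarrow> 'a::ab_group_add \<Rightarrow> 'a"
  shows "multilinear_mod scale s W 2 g \<longleftrightarrow>
    (\<forall>x y b. g [x + y, b] - g [x, b] - g [y, b] \<in> W) \<and>
    (\<forall>x y a. g [a, x + y] - g [a, x] - g [a, y] \<in> W) \<and>
    (\<forall>c x b. g [scale c x, b] - s c (g [x, b]) \<in> W) \<and>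
    (\<forall>c x a. g [a, scale c x] - s c (g [a, x]) \<in> W)" (is "?L \<longleftrightarrow> ?R")
proof
  assume L: ?L
  show ?R
    using L[unfolded multilinear_mod_def, THEN conjunct1, rule_format, of "[_, _]" 0]
      L[unfolded multilinear_mod_def, THEN conjunct1, rule_format, of "[_, _]" 1]
      L[unfolded multilinear_mod_def, THEN conjunct2, rule_format, of "[_, _]" 0]
      L[unfolded multilinear_mod_def, THEN conjunct2, rule_format, of "[_, _]" 1]
    by simp
next
  assume R: ?R
  have *: "(\<exists>a b. xs = [a, b]) \<and> (i = 0 \<or> i = 1)" if "length xs = 2" "i < 2" for xs :: "'a list" and i :: nat
    using that by (auto simp: numeral_2_eq_2 length_Suc_conv)
  show ?L
    unfolding multilinear_mod_def
  proof (intro conjI allI impI)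
    fix xs :: "'a list" and i :: nat and x y
    assume "length xs = 2 \<and> i < 2"
    with * obtain a b where "xs = [a, b]" "i = 0 \<or> i = 1" by blast
    with R show "g (xs[i := x + y]) - g (xs[i := x]) - g (xs[i := y]) \<in> W" by auto
  next
    fix xs :: "'a list" and i :: nat and r x
    assume "length xs = 2 \<and> i < 2"
    with * obtain a b where "xs = [a, b]" "i = 0 \<or> i = 1" by blast
    with R show "g (xs[i := scale r x]) - s r (g (xs[i := x])) \<in> W" by auto
  qed
qed

lemma multilinear_mod_3_iff:
  fixes scale :: "'k::field \<Rightarrow> 'a::ab_group_add \<Rightarrow> 'a"
  shows "multilinear_mod scale s W 3 g \<longleftrightarrow>
    (\<forall>x y b c. g [x + y, b, c] - g [x, b, c] - g [y, b, c] \<in> W) \<and>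
    (\<forall>x y a c. g [a, x + y, c] - g [a, x, c] - g [a, y, c] \<in> W) \<and>
    (\<forall>x y a b. g [a, b, x + y] - g [a, b, x] - g [a, b, y] \<in> W) \<and>
    (\<forall>r x b c. g [scale r x, b, c] - s r (g [x, b, c]) \<in> W) \<and>
    (\<forall>r x a c. g [a, scale r x, c] - s r (g [a, x, c]) \<in> W) \<and>
    (\<forall>r x a b. g [a, b, scale r x] - s r (g [a, b, x]) \<in> W)" (is "?L \<longleftrightarrow> ?R")
proof
  assume L: ?L
  show ?R
    using L[unfolded multilinear_mod_def, THEN conjunct1, rule_format, of "[_, _, _]" 0]
      L[unfolded multilinear_mod_def, THEN conjunct1, rule_format, of "[_, _, _]" 1]
      L[unfolded multilinear_mod_def, THEN conjunct1, rule_format, of "[_, _, _]" 2]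
      L[unfolded multilinear_mod_def, THEN conjunct2, rule_format, of "[_, _, _]" 0]
      L[unfolded multilinear_mod_def, THEN conjunct2, rule_format, of "[_, _, _]" 1]
      L[unfolded multilinear_mod_def, THEN conjunct2, rule_format, of "[_, _, _]" 2]
    by simp
next
  assume R: ?R
  have *: "(\<exists>a b c. xs = [a, b, c]) \<and> (i = 0 \<or> i = 1 \<or> i = 2)"
    if "length xs = 3" "i < 3" for xs :: "'a list" and i :: nat
    using that by (auto simp: numeral_3_eq_3 length_Suc_conv)
  show ?L
    unfolding multilinear_mod_def
  proof (intro conjI allI impI)
    fix xs :: "'a list" and i :: nat and x y
    assume "length xs = 3 \<and> i < 3"
    with * obtain a b c where "xs = [a, b, c]" "i = 0 \<or> i = 1 \<or> i = 2" by blast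
    with R show "g (xs[i := x + y]) - g (xs[i := x]) - g (xs[i := y]) \<in> W" by auto
  next
    fix xs :: "'a list" and i :: nat and r x
    assume "length xs = 3 \<and> i < 3"
    with * obtain a b c where "xs = [a, b, c]" "i = 0 \<or> i = 1 \<or> i = 2" by blast
    with R show "g (xs[i := scale r x]) - s r (g (xs[i := x])) \<in> W" by auto
  qed
qed

lemma subspace_tensor_relations: "formal.subspace (tensor_relations scale m)"
  unfolding tensor_relations_def by (rule formal.subspace_span)

text \<open>
The tensor relations are generated by the failure of this map to be multilinear.  Read
slotwise, the lemma thus supplies all generating relations.
\<close>

lemma multilinear_mod_single:
  "multilinear_mod scale formal_scale (tensor_relations scale m) m (\<lambda>xs. Poly_Mapping.single xs 1)"
  unfolding multilinear_mod_def tensor_relations_def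
proof (intro conjI allI impI formal.span_base, goal_cases)
  case (1 xs i x y)
  then show ?case by (intro UnI1) blast
next
  case (2 xs i c x)
  then show ?case by (intro UnI2 CollectI exI[of _ xs] exI[of _ i] exI[of _ c] exI[of _ x]) simp
qed

text \<open>
The universal property of the tensor power: a multilinear map annihilates the generators of the
relations, hence their span.
\<close>

lemma (in vector_space) lin_ext_tensor_relations:
  assumes "multilinear_mod sc scale W m g" "subspace W" "p \<in> tensor_relations sc m"
  shows "lin_ext scale g p \<in> W"
proof -
  interpret lin: Vector_Spaces.linear formal_scale scale "lin_ext scale g" by (rule linear_lin_ext)
  have "tensor_relations sc m \<subseteq> {p. lin_ext scale g p \<in> W}"
    unfolding tensor_relations_def
    by (rule formal.span_minimal)
       (use assms in \<open>auto simp: multilinear_mod_def lin.diff lin.subspace_linear_preimage\<close>)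
  with assms show ?thesis by blast
qed

section \<open>Spaces of cosets\<close>

text \<open>
The structure \<open>M\<close> is the quotient of \<open>D\<close> by \<open>W\<close>, with projection \<open>\<pi>\<close>.  Tensor powers, the
representation algebra and the algebra of trace functions all have this form.  The domain \<open>D\<close> is
what tells the last two apart, and singles out the lists of the correct length for the first.
\<close>

locale presented_space = vector_space scale
  for scale :: "'k::field \<Rightarrow> 'v::ab_group_add \<Rightarrow> 'v" +
  fixes M :: "('k, 'r, 'm) module_scheme" and \<pi> :: "'v \<Rightarrow> 'r" and D W :: "'v set"
  assumes subspace_D: "subspace D" and subspace_W: "subspace W"
    and carrier_eq: "carrier M = \<pi> ` D"
    and zero_eq: "\<zero>\<^bsub>M\<^esub> = \<pi> 0"
    and add_eq: "x \<in> D \<Longrightarrow> y \<in> D \<Longrightarrow> \<pi> x \<oplus>\<^bsub>M\<^esub> \<pi> y = \<pi> (x + y)"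
    and smult_eq: "x \<in> D \<Longrightarrow> c \<odot>\<^bsub>M\<^esub> \<pi> x = \<pi> (scale c x)"
    and proj_eq_iff: "x \<in> D \<Longrightarrow> y \<in> D \<Longrightarrow> \<pi> x = \<pi> y \<longleftrightarrow> x - y \<in> W"
begin

lemmas D_simps = subspace_0[OF subspace_D] subspace_add[OF subspace_D]
  subspace_scale[OF subspace_D] subspace_neg[OF subspace_D] subspace_diff[OF subspace_D]

lemma proj_eqI: "x \<in> D \<Longrightarrow> y \<in> D \<Longrightarrow> x - y \<in> W \<Longrightarrow> \<pi> x = \<pi> y"
  by (simp add: proj_eq_iff)

lemma abelian_group: "abelian_group M"
proof (rule abelian_groupI)
  fix x assume "x \<in> carrier M"
  then obtain v where "v \<in> D" "x = \<pi> v" by (auto simp: carrier_eq)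
  then show "\<exists>y\<in>carrier M. y \<oplus>\<^bsub>M\<^esub> x = \<zero>\<^bsub>M\<^esub>"
    by (intro bexI[of _ "\<pi> (- v)"]) (simp_all add: carrier_eq zero_eq add_eq D_simps)
qed (auto simp: carrier_eq zero_eq add_eq D_simps ac_simps)

lemma a_inv_eq: "x \<in> D \<Longrightarrow> \<ominus>\<^bsub>M\<^esub> \<pi> x = \<pi> (- x)"
  by (rule abelian_group.minus_equality[OF abelian_group])
     (simp_all add: carrier_eq zero_eq add_eq D_simps)

lemma finsum_eq:
  assumes "finite A" "\<And>x. x \<in> A \<Longrightarrow> g x \<in> D"
  shows "finsum M (\<lambda>x. \<pi> (g x)) A = \<pi> (\<Sum>x\<in>A. g x)"
proof -
  interpret abelian_group M by (rule abelian_group)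
  from assms show ?thesis
  proof (induction A rule: finite_induct)
    case (insert x A)
    then show ?case
      by (subst finsum_insert) (auto simp: carrier_eq add_eq subspace_sum[OF subspace_D])
  qed (simp add: zero_eq)
qed

end

definition tensor_class ::
    "('k::field \<Rightarrow> 'a::ab_group_add \<Rightarrow> 'a) \<Rightarrow> nat \<Rightarrow> ('a list \<Rightarrow>\<^sub>0 'k) \<Rightarrow> ('a list \<Rightarrow>\<^sub>0 'k) set" where
  "tensor_class scale m p = (+) p ` tensor_relations scale m"

definition tensor_reps :: "nat \<Rightarrow> ('a list \<Rightarrow>\<^sub>0 'k::zero) set" where
  "tensor_reps m = {p. Poly_Mapping.keys p \<subseteq> {xs. length xs = m}}"

lemma r_coset_free_lists:
  "tensor_relations scale m +>\<^bsub>free_lists m\<^esub> p = tensor_class scale m p"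
  by (auto simp: a_r_coset_def' free_lists_def tensor_class_def add.commute)

lemma pure_tensor_eq: "length xs = m \<Longrightarrow> pure_tensor scale xs = tensor_class scale m (Poly_Mapping.single xs 1)"
  by (auto simp: pure_tensor_def r_coset_free_lists)

text \<open>
The three lemmas on translates state the arithmetic of cosets without reference to the record that
carries the operations, because tensor powers and the representation algebra define their
operations on cosets through different records.
\<close>

lemma translate_eq_iff:
  fixes W :: "'v::ab_group_add set"
  assumes "0 \<in> W" "\<And>x y. x \<in> W \<Longrightarrow> y \<in> W \<Longrightarrow> x + y \<in> W" "\<And>x. x \<in> W \<Longrightarrow> - x \<in> W"
  shows "(+) p ` W = (+) q ` W \<longleftrightarrow> p - q \<in> W"
proof
  assume "(+) p ` W = (+) q ` W"
  moreover have "p \<in> (+) p ` W" using assms(1) by (force intro: image_eqI[of _ _ 0])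
  ultimately obtain w where "w \<in> W" "p = q + w" by auto
  then show "p - q \<in> W" by simp
next
  assume d: "p - q \<in> W"
  have "(+) p ` W \<subseteq> (+) q ` W" if "p - q \<in> W" for p q
  proof
    fix z assume "z \<in> (+) p ` W"
    then obtain w where "w \<in> W" "z = p + w" by auto
    with that assms(2) show "z \<in> (+) q ` W"
      by (intro image_eqI[of _ _ "(p - q) + w"]) simp_all
  qed
  from this[OF d] this[of q p] assms(3)[OF d] show "(+) p ` W = (+) q ` W" by auto
qed

lemma translate_add:
  fixes W :: "'v::ab_group_add set"
  assumes "0 \<in> W" "\<And>x y. x \<in> W \<Longrightarrow> y \<in> W \<Longrightarrow> x + y \<in> W"
  shows "(\<Union>x\<in>W. \<Union>y\<in>W. {p + x + (q + y)}) = (+) (p + q) ` W"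
proof safe
  fix x y assume "x \<in> W" "y \<in> W"
  with assms(2) show "p + x + (q + y) \<in> (+) (p + q) ` W"
    by (intro image_eqI[of _ _ "x + y"]) (simp_all add: ac_simps)
next
  fix x assume "x \<in> W"
  with assms(1) show "p + q + x \<in> (\<Union>x\<in>W. \<Union>y\<in>W. {p + x + (q + y)})"
    by (intro UN_I[of x] UN_I[of 0]) (auto simp: ac_simps)
qed

lemma translate_scale:
  assumes "0 \<in> W" "\<And>x y. x \<in> W \<Longrightarrow> y \<in> W \<Longrightarrow> x + y \<in> W" "\<And>x. x \<in> W \<Longrightarrow> - x \<in> W"
    "\<And>w. w \<in> W \<Longrightarrow> s w \<in> W" "\<And>x y. s (x + y) = s x + s (y::'v::ab_group_add)"
  shows "(\<Union>x\<in>(+) p ` W. (+) (s x) ` W) = (+) (s p) ` W"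
proof -
  have "(+) (s x) ` W = (+) (s p) ` W" if "x \<in> (+) p ` W" for x
  proof -
    from that obtain w where "w \<in> W" "x = p + w" by auto
    with assms(4,5) show ?thesis by (subst translate_eq_iff[OF assms(1-3)]) simp_all
  qed
  then have "(\<Union>x\<in>(+) p ` W. (+) (s x) ` W) = (\<Union>x\<in>(+) p ` W. (+) (s p) ` W)"
    by (rule SUP_cong[OF refl])
  also have "\<dots> = (+) (s p) ` W" using assms(1) by (simp only: UN_constant) auto
  finally show ?thesis .
qed

lemma presented_tensor_power:
  "presented_space formal_scale (tensor_power scale m) (tensor_class scale m) (tensor_reps m)
    (tensor_relations scale m)"
proof -
  note S = subspace_tensor_relations[of scale m]
  note W = formal.subspace_0[OF S] formal.subspace_add[OF S] formal.subspace_neg[OF S]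
    formal.subspace_scale[OF S]
  show ?thesis
  proof
    show "formal.subspace (tensor_reps m)"
      unfolding tensor_reps_def by (rule subspace_keys)
    show "formal.subspace (tensor_relations scale m)" by (rule S)
    show "carrier (tensor_power scale m) = tensor_class scale m ` tensor_reps m"
      by (auto simp: tensor_power_def Let_def A_RCOSETS_def' r_coset_free_lists tensor_reps_def)
         (auto simp: free_lists_def)
    show "\<zero>\<^bsub>tensor_power scale m\<^esub> = tensor_class scale m 0"
      by (simp add: tensor_power_def Let_def tensor_class_def)
    show "tensor_class scale m x \<oplus>\<^bsub>tensor_power scale m\<^esub> tensor_class scale m y
        = tensor_class scale m (x + y)" for x y
      using translate_add[of "tensor_relations scale m" x y, OF W(1,2)]
      by (simp add: tensor_power_def Let_def set_add_def' free_lists_def tensor_class_def)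
    show "c \<odot>\<^bsub>tensor_power scale m\<^esub> tensor_class scale m x = tensor_class scale m (formal_scale c x)" for c x
      using translate_scale[of "tensor_relations scale m" "formal_scale c" x, OF W formal.scale_right_distrib]
      by (simp add: tensor_power_def Let_def coset_smult_def r_coset_free_lists)
         (simp add: tensor_class_def free_lists_def)
    show "tensor_class scale m x = tensor_class scale m y \<longleftrightarrow> x - y \<in> tensor_relations scale m" for x y
      unfolding tensor_class_def by (rule translate_eq_iff) (use W in auto)
  qed
qed

text \<open>
A lift evaluates some element of the coset.  Any two elements differ by a tensor relation, which a
multilinear map sends into \<open>W\<close>, so the linear extension of \<open>g\<close> may be evaluated at a
representative of one's choice.
\<close>

lemma (in presented_space) tensor_lift_class:
  assumes "multilinear_mod sc scale W m g" "\<And>xs. g xs \<in> D"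
  shows "tensor_lift M (\<lambda>xs. \<pi> (g xs)) (tensor_class sc m p) = \<pi> (lin_ext scale g p)"
proof -
  define q where "q = (SOME q. q \<in> tensor_class sc m p)"
  have "p \<in> tensor_class sc m p"
    using formal.subspace_0[OF subspace_tensor_relations, of sc m]
    by (auto simp: tensor_class_def intro!: image_eqI[of _ _ 0])
  then have "q \<in> tensor_class sc m p" unfolding q_def by (rule someI)
  then have q: "q - p \<in> tensor_relations sc m" by (auto simp: tensor_class_def)
  have "tensor_lift M (\<lambda>xs. \<pi> (g xs)) (tensor_class sc m p) = \<pi> (lin_ext scale g q)"
    using assms(2) by (simp add: tensor_lift_def q_def[symmetric] smult_eq finsum_eq D_simps lin_ext_def)
  also have "\<dots> = \<pi> (lin_ext scale g p)"
    using lin_ext_tensor_relations[OF assms(1) subspace_W q] assms(2)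
    by (intro proj_eqI) (simp_all add: lin_ext_in_subspace[OF subspace_D] lin_ext_diff)
  finally show ?thesis .
qed

lemma tensor_lift_tensor_class:
  assumes "multilinear_mod scale formal_scale (tensor_relations scale m') m g"
    and "\<And>xs. f xs = tensor_class scale m' (g xs)" "\<And>xs. g xs \<in> tensor_reps m'"
  shows "tensor_lift (tensor_power scale m') f (tensor_class scale m p)
    = tensor_class scale m' (lin_ext formal_scale g p)"
  using presented_space.tensor_lift_class[OF presented_tensor_power assms(1,3), of p]
  by (simp add: assms(2)[abs_def])

section \<open>The polynomial algebra and its ideal\<close>

lemma poly_const_0 [simp]: "poly_const 0 = 0"
  by (simp add: poly_const_def)

lemma poly_const_1 [simp]: "poly_const 1 = 1"
  by (simp add: poly_const_def)

lemma poly_const_add: "poly_const (c + d) = poly_const c + poly_const d"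
  by (simp add: poly_const_def single_add)

lemma poly_const_mult: "poly_const (c * d) = poly_const c * poly_const d"
  by (simp add: poly_const_def mult_single)

interpretation rep_poly: vector_space "\<lambda>c (f :: ('k::field, 'a, 'n) rep_poly). poly_const c * f"
  by unfold_locales (simp_all add: poly_const_add poly_const_mult algebra_simps)

lemma rep_poly_induct [case_names const var add mult]:
  fixes f :: "('k::field, 'a, 'n) rep_poly"
  assumes const: "\<And>c. P (poly_const c)" and var: "\<And>a i j. P (poly_var a i j)"
    and add: "\<And>f g. P f \<Longrightarrow> P g \<Longrightarrow> P (f + g)" and mult: "\<And>f g. P f \<Longrightarrow> P g \<Longrightarrow> P (f * g)"
  shows "P f"
proof -
  have power: "P (Poly_Mapping.single (Poly_Mapping.single x n) 1)" for x :: "'a \<times> 'n \<times> 'n" and n :: nat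
  proof (induction n)
    case 0
    then show ?case using const[of 1] by simp
  next
    case (Suc n)
    obtain a i j where x: "x = (a, i, j)" by (cases x) auto
    have "Poly_Mapping.single (Poly_Mapping.single x (Suc n)) 1
        = poly_var a i j * (Poly_Mapping.single (Poly_Mapping.single x n) 1 :: ('k, 'a, 'n) rep_poly)"
      by (simp add: poly_var_def mult_single single_add[symmetric] x)
    with mult[OF var Suc] show ?case by simp
  qed
  have monomial: "P (Poly_Mapping.single m 1)" for m
  proof (induction m rule: update_induct)
    case const
    then show ?case using assms(1)[of 1] by simp
  next
    case (update m x n)
    have "Poly_Mapping.update x n m = m + Poly_Mapping.single x n"
      using update(1)
      by (intro poly_mapping_eqI) (auto simp: lookup_update lookup_add lookup_single in_keys_iff when_def)
    then have "Poly_Mapping.single (Poly_Mapping.update x n m) 1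
        = Poly_Mapping.single m 1 * (Poly_Mapping.single (Poly_Mapping.single x n) 1 :: ('k, 'a, 'n) rep_poly)"
      by (simp add: mult_single)
    with mult[OF update(3) power] show ?case by simp
  qed
  show ?thesis
  proof (induction f rule: update_induct)
    case const
    then show ?case using assms(1)[of 0] by simp
  next
    case (update f m c)
    have "Poly_Mapping.update m c f = f + poly_const c * Poly_Mapping.single m 1"
      using update(1)
      by (intro poly_mapping_eqI)
         (auto simp: lookup_update lookup_add lookup_single in_keys_iff when_def poly_const_def mult_single)
    with add[OF update(3) mult[OF const monomial]] show ?case by simp
  qed
qed

lemma rep_poly_algebra_simps [simp]:
  "carrier rep_poly_algebra = UNIV" "monoid.mult rep_poly_algebra = (*)" "one rep_poly_algebra = 1"
  "zero rep_poly_algebra = 0" "add rep_poly_algebra = (+)"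
  "smult rep_poly_algebra = (\<lambda>c f. poly_const c * f)"
  by (simp_all add: rep_poly_algebra_def type_algebra_def)

lemma cring_rep_poly_algebra: "cring rep_poly_algebra"
proof (rule cringI)
  show "abelian_group rep_poly_algebra"
    by (rule abelian_groupI) (auto simp: ac_simps intro: exI[of _ "- _"])
qed (unfold_locales, auto simp: algebra_simps)

definition rep_relations ::
    "('k::field \<Rightarrow> 'a::{ring, monoid_mult} \<Rightarrow> 'a) \<Rightarrow> ('k, 'a, 'n::finite) rep_poly set" where
  "rep_relations scale =
    {poly_const r * poly_var a i j + poly_const s * poly_var b i j
        - poly_var (scale r a + scale s b) i j | r s a b i j. True}
     \<union> {poly_var 1 i j - (if i = j then 1 else 0) | i j. True}
     \<union> {poly_var (a * b) i j - (\<Sum>k\<in>UNIV. poly_var a i k * poly_var b k j) | a b i j. True}"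

lemma rep_ideal_eq: "rep_ideal scale = genideal rep_poly_algebra (rep_relations scale)"
  by (simp add: rep_ideal_def rep_relations_def)

lemma ideal_rep_ideal:
  fixes scale :: "'k::field \<Rightarrow> 'a::{ring, monoid_mult} \<Rightarrow> 'a"
  shows "ideal (rep_ideal scale :: ('k, 'a, 'n::finite) rep_poly set) rep_poly_algebra"
proof -
  interpret cring "rep_poly_algebra :: ('k, ('k, 'a, 'n) rep_poly) module" by (rule cring_rep_poly_algebra)
  show ?thesis unfolding rep_ideal_eq by (rule genideal_ideal) simp
qed

lemma rep_relations_subset:
  fixes scale :: "'k::field \<Rightarrow> 'a::{ring, monoid_mult} \<Rightarrow> 'a"
  shows "(rep_relations scale :: ('k, 'a, 'n::finite) rep_poly set) \<subseteq> rep_ideal scale"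
proof -
  interpret cring "rep_poly_algebra :: ('k, ('k, 'a, 'n) rep_poly) module" by (rule cring_rep_poly_algebra)
  show ?thesis unfolding rep_ideal_eq by (rule genideal_self) simp
qed

text \<open>
The description of the ideal as the least one containing the relations, with closure conditions
stated for the operations of the polynomial type.
\<close>

lemma rep_ideal_minimal:
  fixes scale :: "'k::field \<Rightarrow> 'a::{ring, monoid_mult} \<Rightarrow> 'a"
    and J :: "('k, 'a, 'n::finite) rep_poly set"
  assumes "0 \<in> J" "\<And>x y. x \<in> J \<Longrightarrow> y \<in> J \<Longrightarrow> x + y \<in> J" "\<And>x y. y \<in> J \<Longrightarrow> x * y \<in> J"
    and "rep_relations scale \<subseteq> J"
  shows "rep_ideal scale \<subseteq> J"
proof -
  interpret cring "rep_poly_algebra :: ('k, ('k, 'a, 'n) rep_poly) module" by (rule cring_rep_poly_algebra)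
  have neg: "\<ominus>\<^bsub>rep_poly_algebra\<^esub> x = - x" for x :: "('k, 'a, 'n) rep_poly"
    by (rule minus_equality) simp_all
  have "ideal J rep_poly_algebra"
  proof (rule idealI)
    show "ring rep_poly_algebra" by (rule cring.axioms(1)[OF cring_rep_poly_algebra])
    show "subgroup J (add_monoid rep_poly_algebra)"
    proof (rule add.subgroupI)
      show "\<ominus>\<^bsub>rep_poly_algebra\<^esub> x \<in> J" if "x \<in> J" for x
        using assms(3)[OF that, of "-1"] by (simp add: neg)
    qed (use assms(1,2) in auto)
  qed (use assms(3) in \<open>auto simp: mult.commute\<close>)
  then show ?thesis unfolding rep_ideal_eq by (rule genideal_minimal) (rule assms(4))
qed

lemma rep_ideal_closed:
  fixes scale :: "'k::field \<Rightarrow> 'a::{ring, monoid_mult} \<Rightarrow> 'a" and x y :: "('k, 'a, 'n::finite) rep_poly"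
  shows rep_ideal_0: "(0 :: ('k, 'a, 'n) rep_poly) \<in> rep_ideal scale"
    and rep_ideal_add: "x \<in> rep_ideal scale \<Longrightarrow> y \<in> rep_ideal scale \<Longrightarrow> x + y \<in> rep_ideal scale"
    and rep_ideal_mult: "y \<in> rep_ideal scale \<Longrightarrow> x * y \<in> rep_ideal scale"
    and rep_ideal_mult_right: "x \<in> rep_ideal scale \<Longrightarrow> x * y \<in> rep_ideal scale"
proof -
  interpret ideal "rep_ideal scale :: ('k, 'a, 'n) rep_poly set" rep_poly_algebra
    by (rule ideal_rep_ideal)
  show "(0 :: ('k, 'a, 'n) rep_poly) \<in> rep_ideal scale" using additive_subgroup.zero_closed[OF is_additive_subgroup] by simp
  show "x + y \<in> rep_ideal scale" if "x \<in> rep_ideal scale" "y \<in> rep_ideal scale"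
    using additive_subgroup.a_closed[OF is_additive_subgroup that] by simp
  show "x * y \<in> rep_ideal scale" if "y \<in> rep_ideal scale" using I_l_closed[OF that, of x] by simp
  show "x * y \<in> rep_ideal scale" if "x \<in> rep_ideal scale" using I_r_closed[OF that, of y] by simp
qed

lemma rep_ideal_uminus: "x \<in> rep_ideal scale \<Longrightarrow> - x \<in> rep_ideal scale"
  using rep_ideal_mult[of x scale "-1"] by simp

lemma rep_ideal_diff: "x \<in> rep_ideal scale \<Longrightarrow> y \<in> rep_ideal scale \<Longrightarrow> x - y \<in> rep_ideal scale"
  using rep_ideal_add[OF _ rep_ideal_uminus, of x scale y] by simp

lemma subspace_rep_ideal: "rep_poly.subspace (rep_ideal scale)"
  by (intro rep_poly.subspaceI rep_ideal_0 rep_ideal_add rep_ideal_mult)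

section \<open>The representation algebra\<close>

definition rep_class ::
    "('k::field \<Rightarrow> 'a::{ring, monoid_mult} \<Rightarrow> 'a) \<Rightarrow> ('k, 'a, 'n::finite) rep_poly
      \<Rightarrow> ('k, 'a, 'n) rep_poly set" where
  "rep_class scale f = (+) f ` rep_ideal scale"

lemma r_coset_rep_poly: "rep_ideal scale +>\<^bsub>rep_poly_algebra\<^esub> f = rep_class scale f"
  by (auto simp: a_r_coset_def' rep_class_def add.commute)

lemma rep_coord_eq: "rep_coord scale a i j = rep_class scale (poly_var a i j)"
  by (simp add: rep_coord_def r_coset_rep_poly)

lemma rep_algebra_fields:
  "carrier (rep_algebra scale) = carrier (rep_poly_algebra Quot rep_ideal scale)"
  "monoid.mult (rep_algebra scale) = monoid.mult (rep_poly_algebra Quot rep_ideal scale)"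
  "one (rep_algebra scale) = one (rep_poly_algebra Quot rep_ideal scale)"
  "zero (rep_algebra scale) = zero (rep_poly_algebra Quot rep_ideal scale)"
  "add (rep_algebra scale) = add (rep_poly_algebra Quot rep_ideal scale)"
  "smult (rep_algebra scale) = coset_smult rep_poly_algebra (rep_ideal scale)"
  by (simp_all add: rep_algebra_def ring.defs)

lemma rep_mult:
  fixes f :: "('k::field, 'a::{ring, monoid_mult}, 'n::finite) rep_poly"
  shows "rep_class scale f \<otimes>\<^bsub>rep_algebra scale\<^esub> rep_class scale g = rep_class scale (f * g)"
proof -
  interpret ideal "rep_ideal scale :: ('k, 'a, 'n) rep_poly set" rep_poly_algebra
    by (rule ideal_rep_ideal)
  show ?thesis
    using rcoset_mult_add[of f g] by (simp add: rep_algebra_fields FactRing_def r_coset_rep_poly)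
qed

lemma rep_one: "\<one>\<^bsub>rep_algebra scale\<^esub> = rep_class scale 1"
  by (simp add: rep_algebra_fields FactRing_def r_coset_rep_poly)

lemma presented_rep_algebra:
  "presented_space (\<lambda>c f. poly_const c * f) (rep_algebra scale) (rep_class scale) UNIV (rep_ideal scale)"
proof
  note W = rep_ideal_0[of scale] rep_ideal_add[of _ scale] rep_ideal_uminus[of _ scale]
  show "rep_poly.subspace (rep_ideal scale)" by (rule subspace_rep_ideal)
  show "carrier (rep_algebra scale) = range (rep_class scale)"
    by (auto simp: rep_algebra_fields FactRing_def A_RCOSETS_def' r_coset_rep_poly)
  show "\<zero>\<^bsub>rep_algebra scale\<^esub> = rep_class scale 0"
    by (simp add: rep_algebra_fields FactRing_def rep_class_def)
  show "rep_class scale x \<oplus>\<^bsub>rep_algebra scale\<^esub> rep_class scale y = rep_class scale (x + y)" for x y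
    using translate_add[of "rep_ideal scale" x y, OF W(1,2)]
    by (simp add: rep_algebra_fields FactRing_def set_add_def' rep_class_def)
  show "c \<odot>\<^bsub>rep_algebra scale\<^esub> rep_class scale x = rep_class scale (poly_const c * x)" for c x
    using translate_scale[of "rep_ideal scale" "(*) (poly_const c)" x, OF W rep_ideal_mult distrib_left]
    by (simp add: rep_algebra_fields coset_smult_def r_coset_rep_poly) (simp add: rep_class_def)
  show "rep_class scale x = rep_class scale y \<longleftrightarrow> x - y \<in> rep_ideal scale" for x y
    unfolding rep_class_def by (rule translate_eq_iff) (use W in auto)
qed simp

interpretation rep: presented_space "\<lambda>c f. poly_const c * f" "rep_algebra scale" "rep_class scale"
  UNIV "rep_ideal scale" for scale :: "'k::field \<Rightarrow> 'a::{ring, monoid_mult} \<Rightarrow> 'a"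
  by (rule presented_rep_algebra)

section \<open>Derivations of the polynomial algebra\<close>

text \<open>
The Leibniz rule applied to a monomial whose variable \<open>x\<close> has derivative \<open>v x\<close>.  The subtraction of
exponents is truncated, but a variable of exponent zero does not contribute.
\<close>

definition monomial_deriv ::
    "('a \<times> 'n \<times> 'n \<Rightarrow> ('k::field, 'a, 'n) rep_poly) \<Rightarrow> ('a \<times> 'n \<times> 'n \<Rightarrow>\<^sub>0 nat) \<Rightarrow> ('k, 'a, 'n) rep_poly" where
  "monomial_deriv v m = (\<Sum>x\<in>Poly_Mapping.keys m.
    poly_const (of_nat (Poly_Mapping.lookup m x)) * Poly_Mapping.single (m - Poly_Mapping.single x 1) 1 * v x)"

definition poly_deriv ::
    "('a \<times> 'n \<times> 'n \<Rightarrow> ('k::field, 'a, 'n) rep_poly) \<Rightarrow> ('k, 'a, 'n) rep_poly \<Rightarrow> ('k, 'a, 'n) rep_poly" where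
  "poly_deriv v = lin_ext (\<lambda>c f. poly_const c * f) (monomial_deriv v)"

lemma monomial_deriv_superset:
  assumes "finite A" "Poly_Mapping.keys m \<subseteq> A"
  shows "monomial_deriv v m = (\<Sum>x\<in>A. poly_const (of_nat (Poly_Mapping.lookup m x))
    * Poly_Mapping.single (m - Poly_Mapping.single x 1) 1 * v x)"
  unfolding monomial_deriv_def
  by (rule sum.mono_neutral_left) (use assms in \<open>auto simp: in_keys_iff\<close>)

lemma monomial_shift:
  fixes m m' :: "'x \<Rightarrow>\<^sub>0 nat"
  assumes "Poly_Mapping.lookup m x \<noteq> 0"
  shows "m + m' - Poly_Mapping.single x 1 = (m - Poly_Mapping.single x 1) + m'"
  using assms
  by (intro poly_mapping_eqI) (auto simp: minus_poly_mapping.rep_eq lookup_add lookup_single when_def)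

lemma monomial_deriv_mult:
  fixes v :: "'a \<times> 'n \<times> 'n \<Rightarrow> ('k::field, 'a, 'n) rep_poly"
  shows "monomial_deriv v (m + m')
    = Poly_Mapping.single m 1 * monomial_deriv v m' + monomial_deriv v m * Poly_Mapping.single m' 1"
proof -
  let ?A = "Poly_Mapping.keys m \<union> Poly_Mapping.keys m'"
  let ?t = "\<lambda>m x. poly_const (of_nat (Poly_Mapping.lookup m x))
    * (Poly_Mapping.single (m - Poly_Mapping.single x 1) 1 :: ('k, 'a, 'n) rep_poly)"
  have left: "?t m x * Poly_Mapping.single m' 1 = poly_const (of_nat (Poly_Mapping.lookup m x))
      * Poly_Mapping.single (m + m' - Poly_Mapping.single x 1) 1" for m m' x
  proof (cases "Poly_Mapping.lookup m x = 0")
    case False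
    then show ?thesis by (simp only: monomial_shift[OF False] mult_single mult.assoc mult_1)
  qed simp
  have "?t (m + m') x = ?t m x * Poly_Mapping.single m' 1 + ?t m' x * Poly_Mapping.single m 1" for x
    unfolding left by (simp add: lookup_add poly_const_add add.commute distrib_right)
  then show ?thesis
    by (simp add: monomial_deriv_superset[of ?A] keys_add sum_distrib_left sum_distrib_right
        sum.distrib[symmetric] algebra_simps)
qed

lemma poly_deriv_add: "poly_deriv v (f + g) = poly_deriv v f + poly_deriv v g"
  by (simp add: poly_deriv_def rep_poly.lin_ext_add)

lemma poly_deriv_single: "poly_deriv v (Poly_Mapping.single m c) = poly_const c * monomial_deriv v m"
  by (simp add: poly_deriv_def)

lemma poly_deriv_const: "poly_deriv v (poly_const c) = 0"
  by (simp add: poly_const_def poly_deriv_single monomial_deriv_def)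

lemma poly_deriv_var: "poly_deriv v (poly_var a i j) = v (a, i, j)"
  by (simp add: poly_var_def poly_deriv_single monomial_deriv_def)

text \<open>
Both sides are bilinear, which reduces the Leibniz rule to a product of two monomials.
\<close>

lemma poly_deriv_mult: "poly_deriv v (f * g) = f * poly_deriv v g + poly_deriv v f * g"
proof -
  have single: "poly_deriv v (Poly_Mapping.single m c * Poly_Mapping.single m' c')
      = Poly_Mapping.single m c * poly_deriv v (Poly_Mapping.single m' c')
        + poly_deriv v (Poly_Mapping.single m c) * Poly_Mapping.single m' c'" for m c m' c'
  proof -
    have s: "Poly_Mapping.single m c = poly_const c * Poly_Mapping.single m 1" 
      for m :: "'a \<times> 'b \<times> 'b \<Rightarrow>\<^sub>0 nat" and c :: 'c
      by (simp add: poly_const_def mult_single)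
    show ?thesis
      unfolding mult_single poly_deriv_single monomial_deriv_mult poly_const_mult
      by (simp add: s[of m c] s[of m' c'] algebra_simps)
  qed
  have decomp: "Poly_Mapping.update m c f = f + Poly_Mapping.single m c" 
    if "m \<notin> Poly_Mapping.keys f" for m c and f :: "('c, 'a, 'b) rep_poly"
    using that
    by (intro poly_mapping_eqI) (auto simp: lookup_update lookup_add lookup_single in_keys_iff when_def)
  have single_left: "poly_deriv v (Poly_Mapping.single m c * g)
      = Poly_Mapping.single m c * poly_deriv v g + poly_deriv v (Poly_Mapping.single m c) * g" for m c g
  proof (induction g rule: update_induct)
    case const
    then show ?case by (simp add: poly_deriv_def lin_ext_def)
  next
    case (update g m' c')
    then show ?case by (simp add: decomp distrib_left poly_deriv_add single)
  qed
  show ?thesis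
  proof (induction f rule: update_induct)
    case const
    then show ?case by (simp add: poly_deriv_def lin_ext_def)
  next
    case (update f m c)
    then show ?case by (simp add: decomp distrib_right poly_deriv_add single_left)
  qed
qed

lemma poly_deriv_scale: "poly_deriv v (poly_const c * f) = poly_const c * poly_deriv v f"
  by (simp add: poly_deriv_mult poly_deriv_const)

text \<open>
The derivation depends linearly, over the polynomial algebra, on the prescribed values of the
variables.  This makes the bracket below a derivation in its second argument, although it is
constructed by differentiating the first one.
\<close>

lemma poly_deriv_fun_add: "poly_deriv (\<lambda>x. v x + w x) f = poly_deriv v f + poly_deriv w f"
  by (induction f rule: rep_poly_induct)
     (simp_all add: poly_deriv_const poly_deriv_var poly_deriv_add poly_deriv_mult algebra_simps)

lemma poly_deriv_fun_mult: "poly_deriv (\<lambda>x. h * v x) f = h * poly_deriv v f"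
  by (induction f rule: rep_poly_induct)
     (simp_all add: poly_deriv_const poly_deriv_var poly_deriv_add poly_deriv_mult algebra_simps)

lemma poly_deriv_fun_mult_right: "poly_deriv (\<lambda>x. v x * h) f = poly_deriv v f * h"
  using poly_deriv_fun_mult[of h v f] by (simp add: mult.commute)

text \<open>
The biderivation with value \<open>b x y\<close> on the variables \<open>x\<close> and \<open>y\<close>.
\<close>

definition poly_bracket ::
    "('a \<times> 'n \<times> 'n \<Rightarrow> 'a \<times> 'n \<times> 'n \<Rightarrow> ('k::field, 'a, 'n) rep_poly)
      \<Rightarrow> ('k, 'a, 'n) rep_poly \<Rightarrow> ('k, 'a, 'n) rep_poly \<Rightarrow> ('k, 'a, 'n) rep_poly" where
  "poly_bracket b f g = poly_deriv (\<lambda>x. poly_deriv (b x) g) f"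

lemma poly_bracket_var: "poly_bracket b (poly_var a i j) (poly_var a' k l) = b (a, i, j) (a', k, l)"
  by (simp add: poly_bracket_def poly_deriv_var)

lemma poly_bracket_simps:
  "poly_bracket b (f + g) h = poly_bracket b f h + poly_bracket b g h"
  "poly_bracket b f (g + h) = poly_bracket b f g + poly_bracket b f h"
  "poly_bracket b (poly_const c * f) g = poly_const c * poly_bracket b f g"
  "poly_bracket b f (poly_const c * g) = poly_const c * poly_bracket b f g"
  "poly_bracket b (f * g) h = f * poly_bracket b g h + poly_bracket b f h * g"
  "poly_bracket b f (g * h) = g * poly_bracket b f h + poly_bracket b f g * h"
  unfolding poly_bracket_def
  by (simp_all only: poly_deriv_add poly_deriv_scale poly_deriv_fun_add poly_deriv_fun_mult)
     (simp_all only: poly_deriv_mult poly_deriv_fun_add poly_deriv_fun_mult poly_deriv_fun_mult_right)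


lemma poly_bracket_const [simp]:
  "poly_bracket b (poly_const c) g = 0" "poly_bracket b f (poly_const c) = 0"
  using poly_deriv_fun_mult[of 0 "\<lambda>_. 0" f] by (simp_all add: poly_bracket_def poly_deriv_const)


lemma poly_bracket_0 [simp]: "poly_bracket b 0 g = 0" "poly_bracket b f 0 = 0"
  using poly_bracket_const(1)[of b 0 g] poly_bracket_const(2)[of b f 0] by simp_all

lemma poly_bracket_diff:
  shows "poly_bracket b (f - f') g = poly_bracket b f g - poly_bracket b f' g"
    and poly_bracket_diff_right: "poly_bracket b f (g - g') = poly_bracket b f g - poly_bracket b f g'"
proof -
  show "poly_bracket b (f - f') g = poly_bracket b f g - poly_bracket b f' g"
    using poly_bracket_simps(1)[of b "f - f'" f' g] by simp
  show "poly_bracket b f (g - g') = poly_bracket b f g - poly_bracket b f g'"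
    using poly_bracket_simps(2)[of b f "g - g'" g'] by simp
qed

lemma poly_bracket_sum:
  shows poly_bracket_sum_left: "poly_bracket b (sum h A) g = (\<Sum>x\<in>A. poly_bracket b (h x) g)"
    and poly_bracket_sum_right: "poly_bracket b f (sum h A) = (\<Sum>x\<in>A. poly_bracket b f (h x))"
  by (induction A rule: infinite_finite_induct) (simp_all add: poly_bracket_simps(1,2))

lemma poly_bracket_lin_ext:
  "poly_bracket b f (lin_ext (\<lambda>c f. poly_const c * f) g p)
    = lin_ext (\<lambda>c f. poly_const c * f) (\<lambda>x. poly_bracket b f (g x)) p"
  by (simp add: lin_ext_def poly_bracket_sum_right poly_bracket_simps(4))


section \<open>Derivations modulo the ideal\<close>

text \<open>
A derivation of the representation algebra, lifted to a map between representatives.  The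
Jacobiator and the lift of an arbitrary bracket of cosets satisfy the rules only modulo the ideal.
\<close>

definition derivation_mod ::
    "('k::field, 'a, 'n) rep_poly set \<Rightarrow> (('k, 'a, 'n) rep_poly \<Rightarrow> ('k, 'a, 'n) rep_poly) \<Rightarrow> bool" where
  "derivation_mod I D \<longleftrightarrow>
    (\<forall>f g. D (f + g) - (D f + D g) \<in> I) \<and>
    (\<forall>c f. D (poly_const c * f) - poly_const c * D f \<in> I) \<and>
    (\<forall>f g. D (f * g) - (f * D g + D f * g) \<in> I)"

lemma derivation_mod_cases:
  fixes D :: "('k::field, 'a::{ring, monoid_mult}, 'n::finite) rep_poly \<Rightarrow> ('k, 'a, 'n) rep_poly"
  assumes D: "derivation_mod (rep_ideal scale) D"
  shows derivation_mod_add_in: "D f \<in> rep_ideal scale \<Longrightarrow> D g \<in> rep_ideal scale \<Longrightarrow> D (f + g) \<in> rep_ideal scale"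
    and derivation_mod_mult_in: "f * D g \<in> rep_ideal scale \<Longrightarrow> D f * g \<in> rep_ideal scale \<Longrightarrow> D (f * g) \<in> rep_ideal scale"
    and derivation_mod_const_in: "D (poly_const c) \<in> rep_ideal scale"
proof -
  let ?I = "rep_ideal scale"
  have add: "D (f + g) - (D f + D g) \<in> ?I" and scale: "D (poly_const c * f) - poly_const c * D f \<in> ?I"
    and mult: "D (f * g) - (f * D g + D f * g) \<in> ?I" for f g c
    using D by (simp_all add: derivation_mod_def)
  show "D (f + g) \<in> ?I" if "D f \<in> ?I" "D g \<in> ?I"
    using rep_ideal_add[OF add[of f g] rep_ideal_add[OF that]] by simp
  show "D (f * g) \<in> ?I" if "f * D g \<in> ?I" "D f * g \<in> ?I"
    using rep_ideal_add[OF mult[of f g] rep_ideal_add[OF that]] by simp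
  \<comment> \<open>The Leibniz rule for \<open>1 * 1\<close> gives \<open>D 1\<close> twice.\<close>
  have one: "D 1 \<in> ?I"
    using rep_ideal_uminus[OF mult[of 1 1]] by simp
  show "D (poly_const c) \<in> ?I"
    using rep_ideal_add[OF scale[of c 1] rep_ideal_mult[OF one, of "poly_const c"]] by simp
qed

text \<open>
The variables and the constants generate the polynomial algebra, and the value of a derivation
at a product lies in the ideal together with the values at the factors.
\<close>

lemma derivation_mod_vanishes:
  assumes D: "derivation_mod (rep_ideal scale) D"
    and var: "\<And>a i j. D (poly_var a i j) \<in> rep_ideal scale"
  shows "D f \<in> rep_ideal scale"
  by (induction f rule: rep_poly_induct)
     (auto intro: derivation_mod_const_in[OF D] var derivation_mod_add_in[OF D]
       derivation_mod_mult_in[OF D] rep_ideal_mult rep_ideal_mult_right)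

text \<open>
The elements of the ideal that a derivation sends into the ideal form an ideal again, so it is
enough that they include the relations.
\<close>

lemma derivation_mod_preserves_ideal:
  assumes D: "derivation_mod (rep_ideal scale) D"
    and rel: "\<And>r. r \<in> rep_relations scale \<Longrightarrow> D r \<in> rep_ideal scale"
    and f: "f \<in> rep_ideal scale"
  shows "D f \<in> rep_ideal scale"
proof -
  have "rep_ideal scale \<subseteq> {f \<in> rep_ideal scale. D f \<in> rep_ideal scale}"
    by (rule rep_ideal_minimal)
       (use rel rep_relations_subset derivation_mod_const_in[OF D, of 0] in
         \<open>auto intro: rep_ideal_closed derivation_mod_add_in[OF D] derivation_mod_mult_in[OF D]\<close>)
  with f show ?thesis by blast
qed

lemma derivation_mod_diff:
  assumes "derivation_mod (rep_ideal scale) D" "derivation_mod (rep_ideal scale) E"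
  shows "derivation_mod (rep_ideal scale) (\<lambda>f. D f - E f)"
  unfolding derivation_mod_def
proof (intro conjI allI)
  fix f g c
  note D = assms[unfolded derivation_mod_def]
  show "D (f + g) - E (f + g) - (D f - E f + (D g - E g)) \<in> rep_ideal scale"
    using rep_ideal_diff[of "D (f + g) - (D f + D g)" scale "E (f + g) - (E f + E g)"] D
    by (simp add: algebra_simps)
  show "D (poly_const c * f) - E (poly_const c * f) - poly_const c * (D f - E f) \<in> rep_ideal scale"
    using rep_ideal_diff[of "D (poly_const c * f) - poly_const c * D f" scale
        "E (poly_const c * f) - poly_const c * E f"] D
    by (simp add: algebra_simps)
  show "D (f * g) - E (f * g) - (f * (D g - E g) + (D f - E f) * g) \<in> rep_ideal scale"
    using rep_ideal_diff[of "D (f * g) - (f * D g + D f * g)" scale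
        "E (f * g) - (f * E g + E f * g)"] D
    by (simp add: algebra_simps)
qed

section \<open>Poisson brackets from their values on generators\<close>

text \<open>
The conditions on the values \<open>b\<close> of a bracket of generators under which the biderivation extending
them becomes a Poisson bracket on the quotient.  All three are conditions on generators.
\<close>

locale rep_bracket =
  fixes scale :: "'k::field \<Rightarrow> 'a::{ring, monoid_mult} \<Rightarrow> 'a"
    and b :: "'a \<times> 'n::finite \<times> 'n \<Rightarrow> 'a \<times> 'n \<times> 'n \<Rightarrow> ('k, 'a, 'n) rep_poly"
  assumes antisym_var: "b x y + b y x \<in> rep_ideal scale"
    and var_relations: "r \<in> rep_relations scale \<Longrightarrow> poly_bracket b (poly_var a i j) r \<in> rep_ideal scale"
    and jacobi_var: "poly_bracket b (poly_var a i j) (b (a', k, l) (a'', p, q))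
      + poly_bracket b (poly_var a' k l) (b (a'', p, q) (a, i, j))
      + poly_bracket b (poly_var a'' p q) (b (a, i, j) (a', k, l)) \<in> rep_ideal scale"
begin

abbreviation "I \<equiv> (rep_ideal scale :: ('k, 'a, 'n) rep_poly set)"
abbreviation "B \<equiv> poly_bracket b"

lemma derivation_B_left: "derivation_mod I (\<lambda>f. B f g)"
  and derivation_B_right: "derivation_mod I (B f)"
  by (simp_all add: derivation_mod_def poly_bracket_simps rep_ideal_0)

text \<open>
The symmetrized bracket is a derivation in each argument, and its values on pairs of variables lie
in the ideal.
\<close>

lemma B_antisym: "B f g + B g f \<in> I"
proof -
  have D: "derivation_mod I (\<lambda>f. B f g + B g f)" for g
    unfolding derivation_mod_def poly_bracket_simps
    by (simp add: rep_ideal_0 distrib_left distrib_right mult.commute mult.left_commute)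
  have var: "B f (poly_var a i j) + B (poly_var a i j) f \<in> I" for f a i j
    by (rule derivation_mod_vanishes[OF D, of "poly_var a i j" f]) (simp add: poly_bracket_var antisym_var)
  show ?thesis
    by (rule derivation_mod_vanishes[OF D[of g], of f]) (use var in \<open>simp add: add.commute\<close>)
qed

text \<open>
The derivation \<open>B f\<close> preserves the ideal if it sends the relations into it; for a given relation
this is again a statement about a derivation, in \<open>f\<close>, and needs to be known for variables only.
\<close>

lemma B_ideal_right: "g \<in> I \<Longrightarrow> B f g \<in> I"
proof (rule derivation_mod_preserves_ideal[OF derivation_B_right])
  show "B f r \<in> I" if "r \<in> rep_relations scale" for r
    by (rule derivation_mod_vanishes[OF derivation_B_left]) (rule var_relations[OF that])
qed

lemma B_ideal_left: "f \<in> I \<Longrightarrow> B f g \<in> I"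
  using rep_ideal_diff[OF B_antisym[of f g] B_ideal_right[of f g]] by simp

lemma B_cong: "f - f' \<in> I \<Longrightarrow> g - g' \<in> I \<Longrightarrow> B f g - B f' g' \<in> I"
  using rep_ideal_add[OF B_ideal_left[of "f - f'" g] B_ideal_right[of "g - g'" f']]
  by (simp add: poly_bracket_diff)

definition "jacobi f g h = B f (B g h) + B g (B h f) + B h (B f g)"

lemma jacobi_rotate: "jacobi f g h = jacobi g h f"
  by (simp add: jacobi_def ac_simps)

text \<open>
The Leibniz rule holds for the Jacobiator because the mixed products of two simple brackets occur
in pairs that antisymmetry cancels.
\<close>

lemma derivation_jacobi: "derivation_mod I (\<lambda>f. jacobi f g h)"
proof -
  have "jacobi (f * f') g h - (f * jacobi f' g h + jacobi f g h * f')
      = B h f' * (B f g + B g f) + B h f * (B f' g + B g f')" for f f'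
    unfolding jacobi_def poly_bracket_simps
    by (simp add: distrib_left distrib_right mult.commute mult.left_commute)
  moreover have "jacobi (f + f') g h - (jacobi f g h + jacobi f' g h) = 0"
    "jacobi (poly_const c * f) g h - poly_const c * jacobi f g h = 0" for f f' c
    unfolding jacobi_def poly_bracket_simps by (simp_all add: distrib_left)
  ultimately show ?thesis
    by (auto simp: derivation_mod_def intro!: rep_ideal_0 rep_ideal_add rep_ideal_mult B_antisym)
qed

text \<open>
Cyclic rotation moves each of the three arguments in turn to the front, where the Jacobiator is a
derivation and its argument can be replaced by a variable.
\<close>

lemma B_jacobi: "jacobi f g h \<in> I"
proof -
  have 1: "jacobi f (poly_var a' k l) (poly_var a'' p q) \<in> I" for f a' k l a'' p q
    by (rule derivation_mod_vanishes[OF derivation_jacobi])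
       (use jacobi_var in \<open>simp add: jacobi_def poly_bracket_var\<close>)
  have 2: "jacobi f g (poly_var a'' p q) \<in> I" for f g a'' p q
    unfolding jacobi_rotate[of f g]
    by (rule derivation_mod_vanishes[OF derivation_jacobi])
       (use 1[of f] jacobi_rotate[of f] in simp)
  show ?thesis
    unfolding jacobi_rotate[of f g] jacobi_rotate[of g h]
    by (rule derivation_mod_vanishes[OF derivation_jacobi])
       (use 2[of f g] jacobi_rotate[of f g] jacobi_rotate[of g _ f] in simp)
qed

text \<open>
The domain \<open>D\<close> is left open so that the lemma serves the representation algebra, where it is
everything, and the subalgebra of trace functions, where only the closure of \<open>D\<close> under \<open>B\<close> is new.
\<close>

lemma poisson_bracket_presented:
  fixes M :: "('k, ('k, 'a, 'n) rep_poly set, 'm) module_scheme"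
  assumes M: "presented_space (\<lambda>c f. poly_const c * f) M (rep_class scale) D I"
    and mult: "\<And>f g. f \<in> D \<Longrightarrow> g \<in> D \<Longrightarrow>
      f * g \<in> D \<and> rep_class scale f \<otimes>\<^bsub>M\<^esub> rep_class scale g = rep_class scale (f * g)"
    and br: "\<And>f g. f \<in> D \<Longrightarrow> g \<in> D \<Longrightarrow>
      B f g \<in> D \<and> br (rep_class scale f) (rep_class scale g) = rep_class scale (B f g)"
  shows "poisson_bracket M br"
proof -
  interpret M: presented_space "\<lambda>c f. poly_const c * f" M "rep_class scale" D I by (rule M)
  note simps = mult br M.add_eq M.smult_eq M.a_inv_eq M.zero_eq M.D_simps
  have "antisymmetric_biderivation M br"
    unfolding antisymmetric_biderivation_def M.carrier_eq
  proof (intro conjI Pi_I ballI allI; clarsimp simp: simps)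
    fix f g h c assume D: "f \<in> D" "g \<in> D" "h \<in> D"
    show "rep_class scale (B f g) = rep_class scale (- B g f)"
      using B_antisym[of f g] D by (intro M.proj_eqI) (simp_all add: simps)
  qed (simp_all add: poly_bracket_simps)
  moreover have "br f (br g h) \<oplus>\<^bsub>M\<^esub> br g (br h f) \<oplus>\<^bsub>M\<^esub> br h (br f g) = \<zero>\<^bsub>M\<^esub>"
    if "f \<in> carrier M" "g \<in> carrier M" "h \<in> carrier M" for f g h
  proof -
    from that obtain x y z where x: "x \<in> D" "y \<in> D" "z \<in> D"
      and eq: "f = rep_class scale x" "g = rep_class scale y" "h = rep_class scale z"
      unfolding M.carrier_eq by blast
    show ?thesis
      unfolding eq using x B_jacobi[of x y z]
      by (simp add: simps) (intro M.proj_eqI; simp add: simps jacobi_def)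
  qed
  ultimately show ?thesis by (simp add: poisson_bracket_def)
qed

definition induced_bracket ::
    "('k, 'a, 'n) rep_poly set \<Rightarrow> ('k, 'a, 'n) rep_poly set \<Rightarrow> ('k, 'a, 'n) rep_poly set" where
  "induced_bracket = (\<lambda>F\<in>carrier (rep_algebra scale). \<lambda>G\<in>carrier (rep_algebra scale).
    rep_class scale (B (SOME f. rep_class scale f = F) (SOME g. rep_class scale g = G)))"

lemma induced_bracket_class:
  "induced_bracket (rep_class scale f) (rep_class scale g) = rep_class scale (B f g)"
proof -
  have "rep_class scale (SOME f'. rep_class scale f' = rep_class scale f) = rep_class scale f" for f
    by (rule someI) (rule refl)
  then have "(SOME f'. rep_class scale f' = rep_class scale f) - f \<in> I" for f
    by (simp add: rep.proj_eq_iff)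
  then show ?thesis
    by (simp add: induced_bracket_def rep.carrier_eq) (intro rep.proj_eqI B_cong; simp)
qed

lemma poisson_induced_bracket: "poisson_bracket (rep_algebra scale) induced_bracket"
  by (rule poisson_bracket_presented[OF presented_rep_algebra])
     (simp_all add: rep_mult induced_bracket_class)

lemma induced_bracket_extensional:
  "induced_bracket \<in> carrier (rep_algebra scale) \<rightarrow>\<^sub>E carrier (rep_algebra scale)
    \<rightarrow>\<^sub>E carrier (rep_algebra scale)"
  by (auto simp: induced_bracket_def rep.carrier_eq)

text \<open>
Lift the given bracket to representatives.  The difference from \<open>B\<close> is a derivation modulo the
ideal in each argument, with values in the ideal on pairs of variables.
\<close>

lemma biderivation_unique:
  assumes br: "br \<in> carrier (rep_algebra scale) \<rightarrow>\<^sub>E carrier (rep_algebra scale) \<rightarrow>\<^sub>E carrier (rep_algebra scale)"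
    and bider: "antisymmetric_biderivation (rep_algebra scale) br"
    and var: "\<And>a i j a' k l. br (rep_coord scale a i j) (rep_coord scale a' k l)
      = rep_class scale (b (a, i, j) (a', k, l))"
  shows "br = induced_bracket"
proof -
  let ?R = "rep_algebra scale" and ?c = "rep_class scale :: ('k, 'a, 'n) rep_poly \<Rightarrow> _"
  \<comment> \<open>A representative of the bracket of two cosets.\<close>
  define \<beta> where "\<beta> f g = (SOME h. rep_class scale h = br (rep_class scale f) (rep_class scale g))" for f g
  have closed: "br (rep_class scale f) (rep_class scale g) \<in> range (rep_class scale)" for f g
    by (rule funcset_mem[OF funcset_mem[OF bider[unfolded antisymmetric_biderivation_def,
          THEN conjunct1, unfolded rep.carrier_eq]]]) simp_all
  have \<beta>: "rep_class scale (\<beta> f g) = br (rep_class scale f) (rep_class scale g)" for f g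
    unfolding \<beta>_def by (rule someI_ex) (use closed[of f g] in auto)
  note eq = rep.proj_eq_iff[of _ _ scale, simplified, symmetric]
  have D: "derivation_mod I (\<lambda>f. \<beta> f g - B f g)" "derivation_mod I (\<lambda>g. \<beta> f g - B f g)" for f g
  proof -
    note bider_eqs = bider[unfolded antisymmetric_biderivation_def, THEN conjunct2, rule_format,
        unfolded rep.carrier_eq, OF rangeI rangeI rangeI]
    have eqs:
      "br (?c f \<oplus>\<^bsub>?R\<^esub> ?c g) (?c h) = br (?c f) (?c h) \<oplus>\<^bsub>?R\<^esub> br (?c g) (?c h)"
      "br (?c f) (?c g \<oplus>\<^bsub>?R\<^esub> ?c h) = br (?c f) (?c g) \<oplus>\<^bsub>?R\<^esub> br (?c f) (?c h)"
      "br (r \<odot>\<^bsub>?R\<^esub> ?c f) (?c g) = r \<odot>\<^bsub>?R\<^esub> br (?c f) (?c g)"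
      "br (?c f) (r \<odot>\<^bsub>?R\<^esub> ?c g) = r \<odot>\<^bsub>?R\<^esub> br (?c f) (?c g)"
      "br (?c f \<otimes>\<^bsub>?R\<^esub> ?c g) (?c h)
        = ?c f \<otimes>\<^bsub>?R\<^esub> br (?c g) (?c h) \<oplus>\<^bsub>?R\<^esub> br (?c f) (?c h) \<otimes>\<^bsub>?R\<^esub> ?c g"
      "br (?c f) (?c g \<otimes>\<^bsub>?R\<^esub> ?c h)
        = ?c g \<otimes>\<^bsub>?R\<^esub> br (?c f) (?c h) \<oplus>\<^bsub>?R\<^esub> br (?c f) (?c g) \<otimes>\<^bsub>?R\<^esub> ?c h"
      for f g h r
      using bider_eqs[of f g h] by blast+
    have "derivation_mod I (\<lambda>f. \<beta> f g)" "derivation_mod I (\<beta> f)" for f g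
      unfolding derivation_mod_def eq
      by ((intro conjI allI, simp only: \<beta> rep.add_eq[OF UNIV_I UNIV_I, symmetric] eqs,
          simp only: \<beta> rep.smult_eq[OF UNIV_I, symmetric] eqs,
          simp only: \<beta> rep.add_eq[OF UNIV_I UNIV_I, symmetric] rep_mult[symmetric] eqs)+)
    note \<beta>D = this
    show "derivation_mod I (\<lambda>f. \<beta> f g - B f g)" for g
      by (rule derivation_mod_diff[OF \<beta>D(1) derivation_B_left])
    show "derivation_mod I (\<lambda>g. \<beta> f g - B f g)" for f
      by (rule derivation_mod_diff[OF \<beta>D(2) derivation_B_right])
  qed
  have "\<beta> f (poly_var a i j) - B f (poly_var a i j) \<in> I" for f a i j
    by (rule derivation_mod_vanishes[OF D(1)])
       (simp add: eq \<beta> poly_bracket_var var[unfolded rep_coord_eq])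
  then have "\<beta> f g - B f g \<in> I" for f g
    by (rule derivation_mod_vanishes[OF D(2)])
  then have "br (rep_class scale f) (rep_class scale g) = rep_class scale (B f g)" for f g
    by (simp add: eq \<beta>)
  then have "br F G = induced_bracket F G"
    if "F \<in> carrier (rep_algebra scale)" "G \<in> carrier (rep_algebra scale)" for F G
    using that by (auto simp: rep.carrier_eq induced_bracket_class)
  then show ?thesis
    using br induced_bracket_extensional by (intro extensionalityI[where A = "carrier (rep_algebra scale)"] ext)
      (auto simp: PiE_iff extensional_def fun_eq_iff)
qed

end

section \<open>Double brackets on representatives\<close>

interpretation tensor: presented_space formal_scale "tensor_power scale m" "tensor_class scale m"
  "tensor_reps m" "tensor_relations scale m" for scale :: "'k::field \<Rightarrow> 'a::ab_group_add \<Rightarrow> 'a" and m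
  by (rule presented_tensor_power)

lemma single_in_tensor_reps [simp]: "length xs = m \<Longrightarrow> Poly_Mapping.single xs c \<in> tensor_reps m"
  by (auto simp: tensor_reps_def)

lemma rep_poly_lin_ext_mult_right:
  "lin_ext (\<lambda>c f. poly_const c * f) (\<lambda>x. g x * h) p
    = lin_ext (\<lambda>c f. poly_const c * f) g p * (h :: ('k::field, 'a, 'n) rep_poly)"
  by (simp add: lin_ext_def sum_distrib_right mult.assoc)

lemma pure_tensor_2: "pure_tensor scale [a, b] = tensor_class scale 2 (Poly_Mapping.single [a, b] 1)"
  and pure_tensor_3: "pure_tensor scale [a, b, c] = tensor_class scale 3 (Poly_Mapping.single [a, b, c] 1)"
  by (rule pure_tensor_eq, simp)+

text \<open>
The indices \<open>i l k j\<close> appear in the order of the bracket formula: \<open>d'\<close> has the indices \<open>i\<close>, \<open>l\<close> and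
\<open>d''\<close> has the indices \<open>k\<close>, \<open>j\<close>.  Likewise \<open>evaluate_3 i q k j p l\<close> is the evaluation of a threefold
tensor that occurs in the Jacobi identity for \<open>a\<^sub>i\<^sub>j\<close>, \<open>b\<^sub>k\<^sub>l\<close> and \<open>c\<^sub>p\<^sub>q\<close>.
\<close>

definition evaluate_2 ::
    "'n \<Rightarrow> 'n \<Rightarrow> 'n \<Rightarrow> 'n \<Rightarrow> ('a list \<Rightarrow>\<^sub>0 'k::field) \<Rightarrow> ('k, 'a, 'n) rep_poly" where
  "evaluate_2 i l k j = lin_ext (\<lambda>c f. poly_const c * f)
    (\<lambda>xs. poly_var (xs ! 0) i l * poly_var (xs ! 1) k j)"

definition evaluate_3 ::
    "'n \<Rightarrow> 'n \<Rightarrow> 'n \<Rightarrow> 'n \<Rightarrow> 'n \<Rightarrow> 'n \<Rightarrow> ('a list \<Rightarrow>\<^sub>0 'k::field) \<Rightarrow> ('k, 'a, 'n) rep_poly" where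
  "evaluate_3 i q k j p l = lin_ext (\<lambda>c f. poly_const c * f)
    (\<lambda>xs. poly_var (xs ! 0) i q * poly_var (xs ! 1) k j * poly_var (xs ! 2) p l)"

definition swap_rep :: "('a list \<Rightarrow>\<^sub>0 'k::field) \<Rightarrow> ('a list \<Rightarrow>\<^sub>0 'k)" where
  "swap_rep = lin_ext formal_scale (\<lambda>xs. Poly_Mapping.single [xs ! 1, xs ! 0] 1)"

definition rotate_rep :: "('a list \<Rightarrow>\<^sub>0 'k::field) \<Rightarrow> ('a list \<Rightarrow>\<^sub>0 'k)" where
  "rotate_rep = lin_ext formal_scale (\<lambda>xs. Poly_Mapping.single [xs ! 2, xs ! 0, xs ! 1] 1)"

definition rotate_back_rep :: "('a list \<Rightarrow>\<^sub>0 'k::field) \<Rightarrow> ('a list \<Rightarrow>\<^sub>0 'k)" where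
  "rotate_back_rep = lin_ext formal_scale (\<lambda>xs. Poly_Mapping.single [xs ! 1, xs ! 2, xs ! 0] 1)"

lemma evaluate_2_swap: "evaluate_2 i l k j (swap_rep p) = evaluate_2 k j i l p"
  unfolding evaluate_2_def swap_rep_def rep_poly.lin_ext_compose
  by (rule rep_poly.lin_ext_cong) (simp add: ac_simps)

text \<open>
A cyclic permutation of the tensor factors amounts to a cyclic permutation of the index pairs, and
thus to passing from one term of the Jacobi identity to the next.
\<close>

lemma evaluate_3_rotate: "evaluate_3 i q k j p l (rotate_rep t) = evaluate_3 k j p l i q t"
  unfolding evaluate_3_def rotate_rep_def rep_poly.lin_ext_compose
  by (rule rep_poly.lin_ext_cong) (simp add: ac_simps)

lemma evaluate_3_rotate_back: "evaluate_3 i q k j p l (rotate_back_rep t) = evaluate_3 p l i q k j t"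
  unfolding evaluate_3_def rotate_back_rep_def rep_poly.lin_ext_compose
  by (rule rep_poly.lin_ext_cong) (simp add: ac_simps)

context
  fixes scale :: "'k::field \<Rightarrow> 'a::ab_group_add \<Rightarrow> 'a"
begin

lemmas tensor_relations_2 = multilinear_mod_single[of scale 2, unfolded multilinear_mod_2_iff]
lemmas tensor_relations_3 = multilinear_mod_single[of scale 3, unfolded multilinear_mod_3_iff]

lemma swap_multilinear: "multilinear_mod scale formal_scale (tensor_relations scale 2) 2
    (\<lambda>xs. Poly_Mapping.single [xs ! 1, xs ! 0] 1)"
  using tensor_relations_2 by (simp add: multilinear_mod_2_iff)

lemma rotate_multilinear: "multilinear_mod scale formal_scale (tensor_relations scale 3) 3
    (\<lambda>xs. Poly_Mapping.single [xs ! 2, xs ! 0, xs ! 1] 1)"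
  using tensor_relations_3 by (simp add: multilinear_mod_3_iff)

lemma rotate_back_multilinear: "multilinear_mod scale formal_scale (tensor_relations scale 3) 3
    (\<lambda>xs. Poly_Mapping.single [xs ! 1, xs ! 2, xs ! 0] 1)"
  using tensor_relations_3 by (simp add: multilinear_mod_3_iff)

lemma append_multilinear: "multilinear_mod scale formal_scale (tensor_relations scale 3) 2
    (\<lambda>xs. Poly_Mapping.single [xs ! 0, xs ! 1, c] 1)"
  using tensor_relations_3 by (simp add: multilinear_mod_2_iff)

lemma tensor_flip_class: "tensor_flip scale (tensor_class scale 2 p) = tensor_class scale 2 (swap_rep p)"
  unfolding tensor_flip_def swap_rep_def
  by (rule tensor_lift_tensor_class[OF swap_multilinear]) (simp_all add: pure_tensor_2)

text \<open>
The action of a permutation places at position \<open>i\<close> the factor with number \<open>\<sigma>\<inverse> i\<close>, so the inverse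
cycles determine the rearranged lists.
\<close>

lemma inv_cycle_123:
  "inv_into UNIV (cycle_of_list [1, 2, 3 :: nat]) 1 = 3"
  "inv_into UNIV (cycle_of_list [1, 2, 3 :: nat]) 2 = 1"
  "inv_into UNIV (cycle_of_list [1, 2, 3 :: nat]) 3 = 2"
  by (rule inv_f_eq; simp add: inj_compose transpose_def)+

lemma inv_cycle_132:
  "inv_into UNIV (cycle_of_list [1, 3, 2 :: nat]) 1 = 2"
  "inv_into UNIV (cycle_of_list [1, 3, 2 :: nat]) 2 = 3"
  "inv_into UNIV (cycle_of_list [1, 3, 2 :: nat]) 3 = 1"
  by (rule inv_f_eq; simp add: inj_compose transpose_def)+

lemma tensor_perm_123: "tensor_perm scale 3 (cycle_of_list [1, 2, 3]) (tensor_class scale 3 p)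
    = tensor_class scale 3 (rotate_rep p)"
proof -
  have "[1..<Suc 3] = [1, 2, 3]" by (simp add: upt_rec)
  then show ?thesis
    unfolding tensor_perm_def rotate_rep_def
    by (intro tensor_lift_tensor_class[OF rotate_multilinear])
       (simp_all only: list.map inv_cycle_123, simp_all add: pure_tensor_3)
qed

lemma tensor_perm_132: "tensor_perm scale 3 (cycle_of_list [1, 3, 2]) (tensor_class scale 3 p)
    = tensor_class scale 3 (rotate_back_rep p)"
proof -
  have "[1..<Suc 3] = [1, 2, 3]" by (simp add: upt_rec)
  then show ?thesis
    unfolding tensor_perm_def rotate_back_rep_def
    by (intro tensor_lift_tensor_class[OF rotate_back_multilinear])
       (simp_all only: list.map inv_cycle_132, simp_all add: pure_tensor_3)
qed

end

lemma rep_relations_mem: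
  fixes scale :: "'k::field \<Rightarrow> 'a::{ring, monoid_mult} \<Rightarrow> 'a"
  shows linear_relation: "poly_const r * poly_var a i j + poly_const s * poly_var b i j
      - poly_var (scale r a + scale s b) i (j :: 'n::finite) \<in> rep_ideal scale"
    and product_relation: "poly_var (a * b) i j - (\<Sum>k\<in>UNIV. poly_var a i k * poly_var b k j)
      \<in> rep_ideal scale"
  by (rule rep_relations_subset[THEN subsetD]; unfold rep_relations_def; blast)+

locale double_bracket_algebra = k_algebra scale
  for scale :: "'k::field_char_0 \<Rightarrow> 'a::{ring, monoid_mult} \<Rightarrow> 'a" +
  fixes dbr :: "'a \<Rightarrow> 'a \<Rightarrow> ('a list \<Rightarrow>\<^sub>0 'k) set"
  assumes double_bracket: "double_bracket scale dbr"
begin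

lemma poly_var_add: "poly_var (a + b) i j - poly_var a i j - poly_var b i (j :: 'n::finite) \<in> rep_ideal scale"
  using rep_ideal_uminus[OF linear_relation[of 1 a i j 1 b scale]] by (simp add: algebra_simps)

lemma poly_var_scale: "poly_var (scale c a) i j - poly_const c * poly_var a i (j :: 'n::finite) \<in> rep_ideal scale"
  using rep_ideal_uminus[OF linear_relation[of c a i j 0 a scale]] by (simp add: algebra_simps)

lemma mult_poly_var_add:
  "h * poly_var (a + b) i j - h * poly_var a i j - h * poly_var b i (j :: 'n::finite) \<in> rep_ideal scale"
  using rep_ideal_mult[OF poly_var_add, of h a b i j] by (simp add: right_diff_distrib)

lemma mult_poly_var_scale:
  "h * poly_var (scale c a) i j - poly_const c * (h * poly_var a i (j :: 'n::finite)) \<in> rep_ideal scale"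
  using rep_ideal_mult[OF poly_var_scale, of h c a i j] by (simp add: right_diff_distrib mult.left_commute)

lemma evaluate_2_multilinear:
  "multilinear_mod scale (\<lambda>c f. poly_const c * f) (rep_ideal scale) 2
    (\<lambda>xs. poly_var (xs ! 0) i l * poly_var (xs ! 1) k (j :: 'n::finite))"
  unfolding multilinear_mod_2_iff
proof (intro conjI allI, goal_cases)
  case (1 x y b)
  then show ?case using mult_poly_var_add[of "poly_var b k j" x y i l] by (simp add: mult.commute)
next
  case (2 x y a)
  then show ?case using mult_poly_var_add[of "poly_var a i l"] by simp
next
  case (3 c x b)
  then show ?case using mult_poly_var_scale[of "poly_var b k j" c x i l] by (simp add: mult_ac)
next
  case (4 c x a)
  then show ?case using mult_poly_var_scale[of "poly_var a i l"] by simp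
qed

lemma evaluate_3_multilinear:
  "multilinear_mod scale (\<lambda>c f. poly_const c * f) (rep_ideal scale) 3
    (\<lambda>xs. poly_var (xs ! 0) i q * poly_var (xs ! 1) k j * poly_var (xs ! 2) p (l :: 'n::finite))"
  unfolding multilinear_mod_3_iff
proof (intro conjI allI, goal_cases)
  case (1 x y b c)
  then show ?case using mult_poly_var_add[of "poly_var b k j * poly_var c p l" x y i q] by (simp add: mult_ac)
next
  case (2 x y a c)
  then show ?case using mult_poly_var_add[of "poly_var a i q * poly_var c p l" x y k j] by (simp add: mult_ac)
next
  case (3 x y a b)
  then show ?case using mult_poly_var_add[of "poly_var a i q * poly_var b k j"] by simp
next
  case (4 r x b c)
  then show ?case using mult_poly_var_scale[of "poly_var b k j * poly_var c p l" r x i q] by (simp add: mult_ac)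
next
  case (5 r x a c)
  then show ?case using mult_poly_var_scale[of "poly_var a i q * poly_var c p l" r x k j] by (simp add: mult_ac)
next
  case (6 r x a b)
  then show ?case using mult_poly_var_scale[of "poly_var a i q * poly_var b k j"] by simp
qed

lemma evaluate_2_relations: "t \<in> tensor_relations scale 2 \<Longrightarrow> evaluate_2 i l k (j :: 'n::finite) t \<in> rep_ideal scale"
  unfolding evaluate_2_def
  by (rule rep_poly.lin_ext_tensor_relations[OF evaluate_2_multilinear subspace_rep_ideal])

lemma evaluate_3_relations:
  "t \<in> tensor_relations scale 3 \<Longrightarrow> evaluate_3 i q k j p (l :: 'n::finite) t \<in> rep_ideal scale"
  unfolding evaluate_3_def
  by (rule rep_poly.lin_ext_tensor_relations[OF evaluate_3_multilinear subspace_rep_ideal])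

definition dbr_rep :: "'a \<Rightarrow> 'a \<Rightarrow> ('a list \<Rightarrow>\<^sub>0 'k)" where
  "dbr_rep a b = (SOME p. p \<in> tensor_reps 2 \<and> tensor_class scale 2 p = dbr a b)"

lemmas dbr_axioms = double_bracket[unfolded double_bracket_def Let_def]

lemma dbr_closed:
  "dbr a b \<in> carrier (tensor_power scale 2)"
  by (rule dbr_axioms[THEN conjunct1, rule_format])

lemma dbr_add_right:
  "dbr a (b + c) = dbr a b \<oplus>\<^bsub>tensor_power scale 2\<^esub> dbr a c"
  by (rule dbr_axioms[THEN conjunct2, THEN conjunct2, THEN conjunct1, rule_format])

lemma dbr_scale_right:
  "dbr a (scale r b) = r \<odot>\<^bsub>tensor_power scale 2\<^esub> dbr a b"
  by (rule dbr_axioms[THEN conjunct2, THEN conjunct2, THEN conjunct2, THEN conjunct2,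
        THEN conjunct1, rule_format])

lemma dbr_antisym:
  "dbr a b = \<ominus>\<^bsub>tensor_power scale 2\<^esub> tensor_flip scale (dbr b a)"
  by (rule dbr_axioms[THEN conjunct2, THEN conjunct2, THEN conjunct2, THEN conjunct2,
        THEN conjunct2, THEN conjunct1, rule_format])

lemma dbr_mult_right:
  "dbr a (b * c) =
    tensor_lift (tensor_power scale 2) (\<lambda>xs. pure_tensor scale [xs ! 0, b * xs ! 1]) (dbr a c)
    \<oplus>\<^bsub>tensor_power scale 2\<^esub>
    tensor_lift (tensor_power scale 2) (\<lambda>xs. pure_tensor scale [xs ! 0 * c, xs ! 1]) (dbr a b)"
  by (rule dbr_axioms[THEN conjunct2, THEN conjunct2, THEN conjunct2, THEN conjunct2,
        THEN conjunct2, THEN conjunct2, THEN conjunct1, rule_format])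

text \<open>
Every statement about the double bracket is transferred to the chosen representatives, where it
holds modulo the tensor relations.
\<close>

lemma dbr_rep_reps [simp]: "dbr_rep a b \<in> tensor_reps 2"
  and dbr_rep_class: "tensor_class scale 2 (dbr_rep a b) = dbr a b"
proof -
  have "dbr a b \<in> tensor_class scale 2 ` tensor_reps 2"
    using dbr_closed[of a b] by (simp add: tensor.carrier_eq)
  then have "\<exists>p. p \<in> tensor_reps 2 \<and> tensor_class scale 2 p = dbr a b" by auto
  from someI_ex[OF this] show "dbr_rep a b \<in> tensor_reps 2" "tensor_class scale 2 (dbr_rep a b) = dbr a b"
    by (simp_all add: dbr_rep_def)
qed

lemma dbr_rep_keys: "xs \<in> Poly_Mapping.keys (dbr_rep a b) \<Longrightarrow> length xs = 2"
  using dbr_rep_reps[of a b] by (auto simp: tensor_reps_def)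

lemma lin_ext_reps [simp]: "(\<And>xs. g xs \<in> tensor_reps m) \<Longrightarrow> lin_ext formal_scale g p \<in> tensor_reps m"
  unfolding tensor_reps_def by (rule formal.lin_ext_in_subspace[OF subspace_keys])

lemma dbr_rep_add_right: "dbr_rep a (b + c) - (dbr_rep a b + dbr_rep a c) \<in> tensor_relations scale 2"
  and dbr_rep_scale_right: "dbr_rep a (scale r b) - formal_scale r (dbr_rep a b) \<in> tensor_relations scale 2"
proof -
  note simps = tensor.proj_eq_iff[where scale = scale and m = 2, symmetric] dbr_rep_class
    tensor.add_eq[symmetric] tensor.smult_eq[symmetric] tensor.D_simps
  show "dbr_rep a (b + c) - (dbr_rep a b + dbr_rep a c) \<in> tensor_relations scale 2"
    "dbr_rep a (scale r b) - formal_scale r (dbr_rep a b) \<in> tensor_relations scale 2"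
    by (simp_all add: simps dbr_add_right dbr_scale_right)
qed

lemma dbr_rep_antisym: "dbr_rep a b + swap_rep (dbr_rep b a) \<in> tensor_relations scale 2"
proof -
  have "tensor_class scale 2 (dbr_rep a b)
      = \<ominus>\<^bsub>tensor_power scale 2\<^esub> tensor_flip scale (tensor_class scale 2 (dbr_rep b a))"
    unfolding dbr_rep_class by (rule dbr_antisym)
  also have "\<dots> = tensor_class scale 2 (- swap_rep (dbr_rep b a))"
    unfolding tensor_flip_class by (rule tensor.a_inv_eq) (simp add: swap_rep_def)
  finally have "dbr_rep a b - - swap_rep (dbr_rep b a) \<in> tensor_relations scale 2"
    by (subst (asm) tensor.proj_eq_iff) (simp_all add: swap_rep_def tensor.D_simps)
  then show ?thesis by simp
qed

text \<open>
The two inner multiplications of the Leibniz rule for the second argument: from the left on the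
second factor and from the right on the first one.
\<close>

lemma mult_slot_multilinear:
  "multilinear_mod scale formal_scale (tensor_relations scale 2) 2
    (\<lambda>xs. Poly_Mapping.single [xs ! 0, b * xs ! 1] 1)"
  "multilinear_mod scale formal_scale (tensor_relations scale 2) 2
    (\<lambda>xs. Poly_Mapping.single [xs ! 0 * b, xs ! 1] 1)"
  using tensor_relations_2[of scale]
  by (simp_all add: multilinear_mod_2_iff distrib_left distrib_right
      scale_mult_left[symmetric] scale_mult_right[symmetric])

lemma dbr_rep_mult_right:
  "dbr_rep a (b * c) - (lin_ext formal_scale (\<lambda>xs. Poly_Mapping.single [xs ! 0, b * xs ! 1] 1) (dbr_rep a c)
      + lin_ext formal_scale (\<lambda>xs. Poly_Mapping.single [xs ! 0 * c, xs ! 1] 1) (dbr_rep a b))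
    \<in> tensor_relations scale 2"
proof -
  have "tensor_class scale 2 (dbr_rep a (b * c)) =
      tensor_class scale 2 (lin_ext formal_scale (\<lambda>xs. Poly_Mapping.single [xs ! 0, b * xs ! 1] 1) (dbr_rep a c))
      \<oplus>\<^bsub>tensor_power scale 2\<^esub>
      tensor_class scale 2 (lin_ext formal_scale (\<lambda>xs. Poly_Mapping.single [xs ! 0 * c, xs ! 1] 1) (dbr_rep a b))"
    using dbr_mult_right[of a b c]
    unfolding dbr_rep_class[symmetric, of a "b * c"] dbr_rep_class[symmetric, of a b] dbr_rep_class[symmetric, of a c]
    by (simp add: tensor_lift_tensor_class[OF mult_slot_multilinear(1)]
        tensor_lift_tensor_class[OF mult_slot_multilinear(2)] pure_tensor_2)
  then show ?thesis
    by (subst (asm) tensor.add_eq, simp, simp, subst (asm) tensor.proj_eq_iff)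
       (simp_all add: tensor.D_simps)
qed

end

section \<open>The bracket of the representation algebra\<close>

lemma rep_poly_lin_ext_mult_left:
  "lin_ext (\<lambda>c f. poly_const c * f) (\<lambda>x. h * g x) p
    = (h :: ('k::field, 'a, 'n) rep_poly) * lin_ext (\<lambda>c f. poly_const c * f) g p"
  using rep_poly_lin_ext_mult_right[of g h p] by (simp add: mult.commute[of h])

context double_bracket_algebra
begin

definition coord_bracket :: "'a \<times> 'n::finite \<times> 'n \<Rightarrow> 'a \<times> 'n \<times> 'n \<Rightarrow> ('k, 'a, 'n) rep_poly" where
  "coord_bracket x y = (case x of (a, i, j) \<Rightarrow> case y of (b, k, l) \<Rightarrow> evaluate_2 i l k j (dbr_rep a b))"

lemma coord_bracket_simp: "coord_bracket (a, i, j) (b, k, l) = evaluate_2 i l k j (dbr_rep a b)"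
  by (simp add: coord_bracket_def)

lemma evaluate_2_linear:
  "evaluate_2 i l k j (p + q) = evaluate_2 i l k j p + evaluate_2 i l k j q"
  "evaluate_2 i l k j (p - q) = evaluate_2 i l k j p - evaluate_2 i l k j q"
  "evaluate_2 i l k j (formal_scale c p) = poly_const c * evaluate_2 i l k j p"
  by (simp_all add: evaluate_2_def rep_poly.lin_ext_add rep_poly.lin_ext_diff rep_poly.lin_ext_scale)

lemma evaluate_3_linear:
  "evaluate_3 i q k j p l (s + t) = evaluate_3 i q k j p l s + evaluate_3 i q k j p l t"
  by (simp add: evaluate_3_def rep_poly.lin_ext_add)

lemma evaluate_2_antisym:
  "evaluate_2 i l k (j :: 'n::finite) (dbr_rep a b) + evaluate_2 k j i l (dbr_rep b a) \<in> rep_ideal scale"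
  using evaluate_2_relations[OF dbr_rep_antisym, of i l k j a b] by (simp add: evaluate_2_linear evaluate_2_swap)

text \<open>
Apply the Leibniz rule to \<open>1 = 1 * 1\<close>.
\<close>

lemma dbr_rep_one: "dbr_rep a 1 \<in> tensor_relations scale 2"
proof -
  have "lin_ext formal_scale (\<lambda>xs. Poly_Mapping.single [xs ! 0, xs ! 1] 1) (dbr_rep a 1)
      = lin_ext formal_scale (\<lambda>xs. Poly_Mapping.single xs 1) (dbr_rep a 1)"
    by (rule formal.lin_ext_cong) (auto dest!: dbr_rep_keys simp: numeral_2_eq_2 length_Suc_conv)
  then have "lin_ext formal_scale (\<lambda>xs. Poly_Mapping.single [xs ! 0, xs ! 1] 1) (dbr_rep a 1) = dbr_rep a 1"
    by (simp add: lin_ext_basis)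
  with dbr_rep_mult_right[of a 1 1] have "- dbr_rep a 1 \<in> tensor_relations scale 2" by simp
  from formal.subspace_neg[OF subspace_tensor_relations this] show ?thesis by simp
qed

text \<open>
The inner bimodule structure is made for this: expanding the matrix product \<open>X(b) X(d'')\<close> brings out
the entries of \<open>X(b)\<close> as factors of the evaluation of \<open>d\<close> itself.  The same happens for \<open>X(d') X(c)\<close>
in the next lemma.
\<close>

lemma evaluate_2_mult_second:
  "evaluate_2 i l k j (lin_ext formal_scale (\<lambda>xs. Poly_Mapping.single [xs ! 0, b * xs ! 1] 1) q)
    - (\<Sum>p\<in>UNIV. poly_var b k p * evaluate_2 i l p (j :: 'n::finite) q) \<in> rep_ideal scale"
proof -
  have "poly_var x i l * poly_var (b * y) k j
      - (\<Sum>p\<in>UNIV. poly_var b k p * (poly_var x i l * poly_var y p j)) \<in> rep_ideal scale" for x y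
    using rep_ideal_mult[OF product_relation[of b y k j scale], of "poly_var x i l"]
    by (simp add: right_diff_distrib sum_distrib_left mult.left_commute)
  then have "lin_ext (\<lambda>c f. poly_const c * f) (\<lambda>xs. poly_var (xs ! 0) i l * poly_var (b * xs ! 1) k j
      - (\<Sum>p\<in>UNIV. poly_var b k p * (poly_var (xs ! 0) i l * poly_var (xs ! 1) p j))) q \<in> rep_ideal scale"
    by (intro rep_poly.lin_ext_in_subspace[OF subspace_rep_ideal])
  then show ?thesis
    by (simp add: evaluate_2_def rep_poly.lin_ext_compose rep_poly.lin_ext_fun_diff
        rep_poly.lin_ext_fun_sum rep_poly_lin_ext_mult_left)
qed

lemma evaluate_2_mult_first:
  "evaluate_2 i l k j (lin_ext formal_scale (\<lambda>xs. Poly_Mapping.single [xs ! 0 * c, xs ! 1] 1) q)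
    - (\<Sum>p\<in>UNIV. evaluate_2 i p k (j :: 'n::finite) q * poly_var c p l) \<in> rep_ideal scale"
proof -
  have "poly_var (x * c) i l * poly_var y k j
      - (\<Sum>p\<in>UNIV. poly_var x i p * poly_var y k j * poly_var c p l) \<in> rep_ideal scale" for x y
    using rep_ideal_mult_right[OF product_relation[of x c i l scale], of "poly_var y k j"]
    unfolding left_diff_distrib sum_distrib_right by (simp add: mult_ac)
  then have "lin_ext (\<lambda>c f. poly_const c * f) (\<lambda>xs. poly_var (xs ! 0 * c) i l * poly_var (xs ! 1) k j
      - (\<Sum>p\<in>UNIV. poly_var (xs ! 0) i p * poly_var (xs ! 1) k j * poly_var c p l)) q \<in> rep_ideal scale"
    by (intro rep_poly.lin_ext_in_subspace[OF subspace_rep_ideal])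
  then show ?thesis
    by (simp add: evaluate_2_def rep_poly.lin_ext_compose rep_poly.lin_ext_fun_diff
        rep_poly.lin_ext_fun_sum rep_poly_lin_ext_mult_right)
qed

text \<open>
The three kinds of relations correspond to three properties of the double bracket in its second
argument: linearity, vanishing at \<open>1\<close>, and the Leibniz rule.
\<close>

lemma coord_bracket_relations:
  assumes "r \<in> rep_relations scale"
  shows "poly_bracket coord_bracket (poly_var a i (j :: 'n::finite)) r \<in> rep_ideal scale"
proof -
  let ?B = "poly_bracket coord_bracket (poly_var a i j)"
  note simps = poly_bracket_simps poly_bracket_diff poly_bracket_sum_right poly_bracket_var
    coord_bracket_simp
  from assms consider
      (linear) r1 s b c k l where "r = poly_const r1 * poly_var b k l + poly_const s * poly_var c k l
        - poly_var (scale r1 b + scale s c) k l"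
    | (one) k l where "r = poly_var 1 k l - (if k = l then 1 else 0)"
    | (mult) b c k l where "r = poly_var (b * c) k l - (\<Sum>p\<in>UNIV. poly_var b k p * poly_var c p l)"
    unfolding rep_relations_def by blast
  then show ?thesis
  proof cases
    case linear
    note S = subspace_tensor_relations[of scale 2]
    have "- ((dbr_rep a (scale r1 b + scale s c) - (dbr_rep a (scale r1 b) + dbr_rep a (scale s c)))
        + (dbr_rep a (scale r1 b) - formal_scale r1 (dbr_rep a b))
        + (dbr_rep a (scale s c) - formal_scale s (dbr_rep a c)))
        \<in> tensor_relations scale 2"
      by (intro formal.subspace_neg[OF S] formal.subspace_add[OF S] dbr_rep_add_right dbr_rep_scale_right)
    then have "formal_scale r1 (dbr_rep a b) + formal_scale s (dbr_rep a c) - dbr_rep a (scale r1 b + scale s c)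
        \<in> tensor_relations scale 2" by (simp add: algebra_simps)
    from evaluate_2_relations[OF this, of i l k j] show ?thesis
      by (simp add: linear simps evaluate_2_linear)
  next
    case one
    have "?B (if k = l then 1 else 0) = 0" using poly_bracket_const(2)[of coord_bracket "poly_var a i j" 1] by simp
    then show ?thesis
      using evaluate_2_relations[OF dbr_rep_one, of i l k j a] by (simp add: one simps)
  next
    case mult
    \<comment> \<open>The two summands of the Leibniz rule for the double bracket of \<open>a\<close> and \<open>b * c\<close>.\<close>
    let ?c = "lin_ext formal_scale (\<lambda>xs. Poly_Mapping.single [xs ! 0, b * xs ! 1] 1) (dbr_rep a c)"
    let ?b = "lin_ext formal_scale (\<lambda>xs. Poly_Mapping.single [xs ! 0 * c, xs ! 1] 1) (dbr_rep a b)"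
    have eq: "?B r = evaluate_2 i l k j (dbr_rep a (b * c) - (?c + ?b))
        + ((evaluate_2 i l k j ?c - (\<Sum>p\<in>UNIV. poly_var b k p * evaluate_2 i l p j (dbr_rep a c)))
        + (evaluate_2 i l k j ?b - (\<Sum>p\<in>UNIV. evaluate_2 i p k j (dbr_rep a b) * poly_var c p l)))"
      by (simp add: mult simps evaluate_2_linear sum.distrib)
    show ?thesis
      unfolding eq
      by (intro rep_ideal_add evaluate_2_relations dbr_rep_mult_right evaluate_2_mult_second evaluate_2_mult_first)
  qed
qed

subsection \<open>The double Jacobiator on representatives\<close>

text \<open>
The extension of the double bracket with \<open>a\<close> to twofold tensors, acting on the left factor, at the
level of representatives.
\<close>

definition bracket_left :: "'a \<Rightarrow> ('a list \<Rightarrow>\<^sub>0 'k) \<Rightarrow> ('a list \<Rightarrow>\<^sub>0 'k)" where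
  "bracket_left a = lin_ext formal_scale (\<lambda>bs.
    lin_ext formal_scale (\<lambda>xs. Poly_Mapping.single [xs ! 0, xs ! 1, bs ! 1] 1) (dbr_rep a (bs ! 0)))"

text \<open>
In the first slot this is the additivity of the double bracket, transported by a multilinear map;
in the second slot it is the multilinearity of the threefold tensor in its last factor.
\<close>

lemma bracket_left_multilinear:
  "multilinear_mod scale formal_scale (tensor_relations scale 3) 2
    (\<lambda>bs. lin_ext formal_scale (\<lambda>xs. Poly_Mapping.single [xs ! 0, xs ! 1, bs ! 1] 1) (dbr_rep a (bs ! 0)))"
proof -
  note S = subspace_tensor_relations[of scale 3]
  note append = formal.lin_ext_tensor_relations[OF append_multilinear S]
  show ?thesis
    unfolding multilinear_mod_2_iff
  proof (intro conjI allI, goal_cases)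
    case (1 x y b)
    then show ?case
      using append[OF dbr_rep_add_right[of a x y], of b]
      by (simp add: formal.lin_ext_diff formal.lin_ext_add algebra_simps)
  next
    case (2 x y c)
    have "lin_ext formal_scale (\<lambda>xs. Poly_Mapping.single [xs ! 0, xs ! 1, x + y] 1
        - Poly_Mapping.single [xs ! 0, xs ! 1, x] 1 - Poly_Mapping.single [xs ! 0, xs ! 1, y] 1) (dbr_rep a c)
        \<in> tensor_relations scale 3"
      by (rule formal.lin_ext_in_subspace[OF S]) (use tensor_relations_3[of scale] in blast)
    then show ?case by (simp add: formal.lin_ext_fun_diff)
  next
    case (3 r x b)
    then show ?case
      using append[OF dbr_rep_scale_right[of a r x], of b]
      by (simp add: formal.lin_ext_diff formal.lin_ext_scale)
  next
    case (4 r x c)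
    have "lin_ext formal_scale (\<lambda>xs. Poly_Mapping.single [xs ! 0, xs ! 1, scale r x] 1
        - formal_scale r (Poly_Mapping.single [xs ! 0, xs ! 1, x] 1)) (dbr_rep a c) \<in> tensor_relations scale 3"
      by (rule formal.lin_ext_in_subspace[OF S]) (use tensor_relations_3[of scale] in blast)
    then show ?case by (simp only: formal.lin_ext_fun_diff formal.lin_ext_fun_scale nth_Cons_0 nth_Cons_Suc One_nat_def)
  qed
qed

lemma double_bracket_L_class:
  "double_bracket_L scale dbr a (tensor_class scale 2 p) = tensor_class scale 3 (bracket_left a p)"
  unfolding double_bracket_L_def bracket_left_def
proof (rule tensor_lift_tensor_class[OF bracket_left_multilinear])
  show "tensor_lift (tensor_power scale 3) (\<lambda>xs. pure_tensor scale [xs ! 0, xs ! 1, bs ! 1]) (dbr a (bs ! 0))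
      = tensor_class scale 3 (lin_ext formal_scale
          (\<lambda>xs. Poly_Mapping.single [xs ! 0, xs ! 1, bs ! 1] 1) (dbr_rep a (bs ! 0)))" for bs
    unfolding dbr_rep_class[symmetric, of a "bs ! 0"]
    by (rule tensor_lift_tensor_class[OF append_multilinear]) (simp_all add: pure_tensor_3)
qed simp

lemma evaluate_3_bracket_left:
  "evaluate_3 i q k j p l (bracket_left a t)
    = lin_ext (\<lambda>c f. poly_const c * f) (\<lambda>xs. evaluate_2 i q k j (dbr_rep a (xs ! 0)) * poly_var (xs ! 1) p l) t"
  by (simp add: evaluate_3_def bracket_left_def rep_poly.lin_ext_compose evaluate_2_def
      rep_poly_lin_ext_mult_right)

lemma evaluate_bracket_multilinear:
  "multilinear_mod scale (\<lambda>c f. poly_const c * f) (rep_ideal scale) 2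
    (\<lambda>xs. evaluate_2 i q k j (dbr_rep a (xs ! 0)) * poly_var (xs ! 1) p (l :: 'n::finite))"
  unfolding multilinear_mod_2_iff
proof (intro conjI allI, goal_cases)
  case (1 x y b)
  then show ?case
    using rep_ideal_mult_right[OF evaluate_2_relations[OF dbr_rep_add_right[of a x y], of i q k j], of "poly_var b p l"]
    by (simp add: evaluate_2_linear left_diff_distrib distrib_right diff_diff_eq)
next
  case (2 x y c)
  then show ?case using mult_poly_var_add[of "evaluate_2 i q k j (dbr_rep a c)" x y p l] by simp
next
  case (3 r x b)
  then show ?case
    using rep_ideal_mult_right[OF evaluate_2_relations[OF dbr_rep_scale_right[of a r x], of i q k j], of "poly_var b p l"]
    by (simp add: evaluate_2_linear left_diff_distrib mult.assoc)
next
  case (4 r x c)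
  then show ?case using mult_poly_var_scale[of "evaluate_2 i q k j (dbr_rep a c)" r x p l] by simp
qed

text \<open>
The two evaluations come from the two summands of the Leibniz rule.  In the second summand the
bracket with \<open>a\<close> acts on the right factor of the double bracket of \<open>b\<close> and \<open>c\<close>; exchanging the
factors turns it into the left factor of the double bracket of \<open>c\<close> and \<open>b\<close>, at the cost of a sign.
\<close>

lemma nested_coord_bracket:
  "poly_bracket coord_bracket (poly_var a i j) (coord_bracket (b, k, l) (c, p, q))
    - (evaluate_3 i q k j p l (bracket_left a (dbr_rep b c))
      - evaluate_3 i l p j k (q :: 'n::finite) (bracket_left a (dbr_rep c b)))
    \<in> rep_ideal scale"
proof -
  \<comment> \<open>The second summand of the Leibniz rule, as a function of the two factors in exchanged order.\<close>
  let ?S = "\<lambda>xs. evaluate_2 i l p j (dbr_rep a (xs ! 0)) * poly_var (xs ! 1) k q"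
  let ?lin = "lin_ext (\<lambda>c f. poly_const c * f)"
  have "poly_bracket coord_bracket (poly_var a i j) (coord_bracket (b, k, l) (c, p, q))
      = ?lin (\<lambda>xs. evaluate_2 i q k j (dbr_rep a (xs ! 0)) * poly_var (xs ! 1) p l
          + ?S [xs ! 1, xs ! 0]) (dbr_rep b c)"
    unfolding coord_bracket_simp evaluate_2_def[of k] poly_bracket_lin_ext
    by (rule rep_poly.lin_ext_cong)
       (simp add: poly_bracket_simps poly_bracket_var coord_bracket_simp add.commute mult.commute)
  also have "\<dots> = evaluate_3 i q k j p l (bracket_left a (dbr_rep b c)) + ?lin ?S (swap_rep (dbr_rep b c))"
    by (simp add: rep_poly.lin_ext_fun_add evaluate_3_bracket_left swap_rep_def rep_poly.lin_ext_compose)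
  finally have eq: "poly_bracket coord_bracket (poly_var a i j) (coord_bracket (b, k, l) (c, p, q))
      = evaluate_3 i q k j p l (bracket_left a (dbr_rep b c)) + ?lin ?S (swap_rep (dbr_rep b c))" .
  have "?lin ?S (dbr_rep c b + swap_rep (dbr_rep b c)) \<in> rep_ideal scale"
    by (rule rep_poly.lin_ext_tensor_relations[OF evaluate_bracket_multilinear subspace_rep_ideal dbr_rep_antisym])
  then show ?thesis
    by (simp add: eq evaluate_3_bracket_left rep_poly.lin_ext_add add.commute)
qed

end

locale double_poisson_algebra = double_bracket_algebra scale dbr
  for scale :: "'k::field_char_0 \<Rightarrow> 'a::{ring, monoid_mult} \<Rightarrow> 'a"
    and dbr :: "'a \<Rightarrow> 'a \<Rightarrow> ('a list \<Rightarrow>\<^sub>0 'k) set" +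
  assumes jacobiator: "double_jacobiator scale dbr a b c = \<zero>\<^bsub>tensor_power scale 3\<^esub>"
begin

lemma jacobiator_rep:
  "bracket_left a (dbr_rep b c) + rotate_rep (bracket_left b (dbr_rep c a))
    + rotate_back_rep (bracket_left c (dbr_rep a b))
    \<in> tensor_relations scale 3" (is "?j \<in> _")
proof -
  have reps: "bracket_left x t \<in> tensor_reps 3" "rotate_rep t \<in> tensor_reps 3"
    "rotate_back_rep t \<in> tensor_reps 3" for x and t :: "'a list \<Rightarrow>\<^sub>0 'k"
    by (simp_all add: bracket_left_def rotate_rep_def rotate_back_rep_def)
  have "tensor_class scale 3 ?j = tensor_class scale 3 0"
    using jacobiator[of a b c]
    unfolding double_jacobiator_def Let_def dbr_rep_class[symmetric, of b c] dbr_rep_class[symmetric, of c a]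
      dbr_rep_class[symmetric, of a b] double_bracket_L_class
      tensor_perm_123 tensor_perm_132
    by (simp add: tensor.add_eq tensor.zero_eq reps tensor.D_simps)
  then show ?thesis
    by (subst (asm) tensor.proj_eq_iff) (simp_all add: reps tensor.D_simps)
qed

text \<open>
The cyclic sum of the nested brackets is an evaluation of the double Jacobiator of \<open>a\<close>, \<open>b\<close>, \<open>c\<close>
minus one of the double Jacobiator of \<open>a\<close>, \<open>c\<close>, \<open>b\<close>.
\<close>

lemma rep_bracket_coord: "rep_bracket scale (coord_bracket :: 'a \<times> 'n::finite \<times> 'n \<Rightarrow> _)"
proof
  fix x y :: "'a \<times> 'n \<times> 'n"
  show "coord_bracket x y + coord_bracket y x \<in> rep_ideal scale"
    by (cases x; cases y) (simp add: coord_bracket_simp evaluate_2_antisym)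
next
  fix r :: "('k, 'a, 'n) rep_poly" and a and i j :: 'n
  assume "r \<in> rep_relations scale"
  then show "poly_bracket coord_bracket (poly_var a i j) r \<in> rep_ideal scale"
    by (rule coord_bracket_relations)
next
  fix a b c :: 'a and i j k l p q :: 'n
  \<comment> \<open>A nested bracket and its positive and negative part from \<open>nested_coord_bracket\<close>.\<close>
  let ?N = "\<lambda>a i j b k l c p q. poly_bracket coord_bracket (poly_var a i j) (coord_bracket (b, k, l) (c, p, q))"
  let ?pos = "\<lambda>a i j b k l c p q. evaluate_3 i q k j p l (bracket_left a (dbr_rep b c))"
  let ?neg = "\<lambda>a i j b k l c p q. evaluate_3 i l p j k q (bracket_left a (dbr_rep c b))"
  have pos: "?pos a i j b k l c p q + ?pos b k l c p q a i j + ?pos c p q a i j b k l \<in> rep_ideal scale"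
    using evaluate_3_relations[OF jacobiator_rep, of i q k j p l a b c]
    by (simp add: evaluate_3_linear evaluate_3_rotate evaluate_3_rotate_back)
  have neg: "?neg a i j b k l c p q + ?neg b k l c p q a i j + ?neg c p q a i j b k l \<in> rep_ideal scale"
    using evaluate_3_relations[OF jacobiator_rep, of i l p j k q a c b]
    by (simp add: evaluate_3_linear evaluate_3_rotate evaluate_3_rotate_back ac_simps)
  have "(?N a i j b k l c p q - (?pos a i j b k l c p q - ?neg a i j b k l c p q))
      + (?N b k l c p q a i j - (?pos b k l c p q a i j - ?neg b k l c p q a i j))
      + (?N c p q a i j b k l - (?pos c p q a i j b k l - ?neg c p q a i j b k l))
      + ((?pos a i j b k l c p q + ?pos b k l c p q a i j + ?pos c p q a i j b k l)
        - (?neg a i j b k l c p q + ?neg b k l c p q a i j + ?neg c p q a i j b k l)) \<in> rep_ideal scale"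
    by (rule rep_ideal_add[OF rep_ideal_add[OF rep_ideal_add[OF nested_coord_bracket
          nested_coord_bracket] nested_coord_bracket] rep_ideal_diff[OF pos neg]])
  then show "?N a i j b k l c p q + ?N b k l c p q a i j + ?N c p q a i j b k l \<in> rep_ideal scale"
    by (simp add: algebra_simps)
qed

end

section \<open>Trace functions\<close>

definition poly_trace :: "'a \<Rightarrow> ('k::field, 'a, 'n::finite) rep_poly" where
  "poly_trace a = (\<Sum>i\<in>UNIV. poly_var a i i)"

text \<open>
The preimage of the trace functions under the projection.  With it as domain, the algebra of
trace functions is a space of cosets like the representation algebra.
\<close>

definition trace_reps ::
    "('k::field \<Rightarrow> 'a::{ring, monoid_mult} \<Rightarrow> 'a) \<Rightarrow> ('k, 'a, 'n::finite) rep_poly set" where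
  "trace_reps scale = {f. rep_class scale f \<in> carrier (trace_algebra scale)}"

lemma trace_algebra_fields:
  "carrier (trace_algebra scale) = generated_subalgebra (rep_algebra scale) (range (rep_trace scale))"
  "monoid.mult (trace_algebra scale) = monoid.mult (rep_algebra scale)"
  "zero (trace_algebra scale) = zero (rep_algebra scale)"
  "add (trace_algebra scale) = add (rep_algebra scale)"
  "smult (trace_algebra scale) = smult (rep_algebra scale)"
  by (simp_all add: trace_algebra_def)

lemma rep_trace_eq: "rep_trace scale a = rep_class scale (poly_trace a)"
  by (simp add: rep_trace_def rep_coord_eq poly_trace_def rep.finsum_eq)

lemma trace_reps_closed:
  fixes scale :: "'k::field \<Rightarrow> 'a::{ring, monoid_mult} \<Rightarrow> 'a"
    and f g :: "('k, 'a, 'n::finite) rep_poly"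
  shows trace_reps_one: "(1 :: ('k, 'a, 'n) rep_poly) \<in> trace_reps scale"
    and trace_reps_trace: "(poly_trace a :: ('k, 'a, 'n) rep_poly) \<in> trace_reps scale"
    and trace_reps_add: "f \<in> trace_reps scale \<Longrightarrow> g \<in> trace_reps scale \<Longrightarrow> f + g \<in> trace_reps scale"
    and trace_reps_mult: "f \<in> trace_reps scale \<Longrightarrow> g \<in> trace_reps scale \<Longrightarrow> f * g \<in> trace_reps scale"
    and trace_reps_scale: "f \<in> trace_reps scale \<Longrightarrow> poly_const c * f \<in> trace_reps scale"
  using generated_subalgebra.one[of "rep_algebra scale" "range (rep_trace scale)"]
    generated_subalgebra.gen[of "rep_trace scale a" "range (rep_trace scale)" "rep_algebra scale"]
    generated_subalgebra.add[of "rep_class scale f" "rep_algebra scale" "range (rep_trace scale)" "rep_class scale g"]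
    generated_subalgebra.mult[of "rep_class scale f" "rep_algebra scale" "range (rep_trace scale)" "rep_class scale g"]
    generated_subalgebra.smult[of "rep_class scale f" "rep_algebra scale" "range (rep_trace scale)" c]
  by (simp_all add: trace_reps_def trace_algebra_fields rep_one rep_trace_eq rep.add_eq rep.smult_eq rep_mult)

lemma trace_reps_0: "0 \<in> trace_reps scale"
  using trace_reps_scale[OF trace_reps_one, of 0 scale] by simp

lemma trace_reps_cong: "f - g \<in> rep_ideal scale \<Longrightarrow> f \<in> trace_reps scale \<longleftrightarrow> g \<in> trace_reps scale"
  by (simp add: trace_reps_def rep.proj_eqI)

lemma subspace_trace_reps: "rep_poly.subspace (trace_reps scale)"
  by (intro rep_poly.subspaceI trace_reps_0 trace_reps_add trace_reps_scale)

lemma carrier_trace_subset: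
  "carrier (trace_algebra scale) \<subseteq> range (rep_class scale)"
proof
  fix F assume "F \<in> carrier (trace_algebra scale)"
  then have "F \<in> generated_subalgebra (rep_algebra scale) (range (rep_trace scale))"
    by (simp add: trace_algebra_fields)
  then show "F \<in> range (rep_class scale)"
    by induction (auto simp: rep_one rep_trace_eq rep.add_eq rep.smult_eq rep_mult)
qed

lemma presented_trace_algebra:
  "presented_space (\<lambda>c f. poly_const c * f) (trace_algebra scale) (rep_class scale)
    (trace_reps scale) (rep_ideal scale)"
proof
  show "carrier (trace_algebra scale) = rep_class scale ` trace_reps scale"
    using carrier_trace_subset[of scale] by (auto simp: trace_reps_def)
qed (simp_all add: subspace_trace_reps subspace_rep_ideal trace_algebra_fields rep.zero_eq rep.add_eq
    rep.smult_eq rep.proj_eq_iff)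

lemma trace_reps_induct [consumes 1, case_names cong one trace add mult scale]:
  fixes f :: "('k::field, 'a::{ring, monoid_mult}, 'n::finite) rep_poly"
  assumes f: "f \<in> trace_reps scale"
    and cong: "\<And>f g. P f \<Longrightarrow> g - f \<in> rep_ideal scale \<Longrightarrow> P g"
    and one: "P 1" and trace: "\<And>a. P (poly_trace a)"
    and add: "\<And>f g. P f \<Longrightarrow> P g \<Longrightarrow> P (f + g)"
    and mult: "\<And>f g. f \<in> trace_reps scale \<Longrightarrow> g \<in> trace_reps scale \<Longrightarrow> P f \<Longrightarrow> P g \<Longrightarrow> P (f * g)"
    and scale: "\<And>f c. P f \<Longrightarrow> P (poly_const c * f)"
  shows "P f"
proof -
  have "\<exists>f. F = rep_class scale f \<and> f \<in> trace_reps scale \<and> P f"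
    if "F \<in> generated_subalgebra (rep_algebra scale) (range (rep_trace scale))"
    for F :: "('k, 'a, 'n) rep_poly set"
    using that
  proof induction
    case one
    then show ?case using \<open>P 1\<close> trace_reps_one rep_one by blast
  next
    case (gen s)
    then show ?case using trace trace_reps_trace rep_trace_eq by blast
  next
    case (add x y)
    then show ?case using assms(5) trace_reps_add rep.add_eq[OF UNIV_I UNIV_I] by blast
  next
    case (mult x y)
    then show ?case using assms(6) trace_reps_mult rep_mult by blast
  next
    case (smult x c)
    then show ?case using scale trace_reps_scale rep.smult_eq[OF UNIV_I] by blast
  qed
  from this[of "rep_class scale f"] f obtain g where "rep_class scale f = rep_class scale g" "P g"
    by (auto simp: trace_reps_def trace_algebra_fields)
  then show ?thesis using cong by (simp add: rep.proj_eq_iff)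
qed

context rep_bracket
begin

text \<open>
The Leibniz rule passes from traces to everything that they generate, first in the left argument
against a trace and then in the right argument.
\<close>

lemma poisson_trace:
  assumes trace: "\<And>a b'. B (poly_trace a) (poly_trace b') \<in> trace_reps scale"
  shows "poisson_bracket (trace_algebra scale) induced_bracket"
proof -
  have left: "B f (poly_trace a) \<in> trace_reps scale" if "f \<in> trace_reps scale" for f a
    using that
  proof (induction rule: trace_reps_induct)
    case (cong f g)
    then show ?case
      using trace_reps_cong[of "B g (poly_trace a)" "B f (poly_trace a)" scale]
        B_ideal_left[of "g - f" "poly_trace a"]
      by (simp add: poly_bracket_diff)
  next
    case one
    then show ?case using poly_bracket_const(1)[of b 1] by (simp add: trace_reps_0)
  qed (simp_all add: poly_bracket_simps trace trace_reps_add trace_reps_mult trace_reps_scale)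
  have "B f g \<in> trace_reps scale" if "f \<in> trace_reps scale" "g \<in> trace_reps scale" for f g
    using that(2)
  proof (induction rule: trace_reps_induct)
    case (cong g h)
    then show ?case
      using trace_reps_cong[of "B f h" "B f g" scale] B_ideal_right[of "h - g" f]
      by (simp add: poly_bracket_diff)
  next
    case one
    then show ?case using poly_bracket_const(2)[of b f 1] by (simp add: trace_reps_0)
  qed (simp_all add: poly_bracket_simps left that(1) trace_reps_add trace_reps_mult trace_reps_scale)
  then show ?thesis
    by (intro poisson_bracket_presented[OF presented_trace_algebra])
       (simp_all add: trace_reps_mult trace_algebra_fields rep_mult induced_bracket_class)
qed

end

context double_poisson_algebra
begin

text \<open>
The entries of \<open>d'\<close> and \<open>d''\<close> that survive in the double sum are those of the trace of a matrix
product, so the bracket of the traces of \<open>a\<close> and \<open>b\<close> is the trace of \<open>d' d''\<close>.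
\<close>

lemma bracket_of_traces:
  "poly_bracket coord_bracket (poly_trace a) (poly_trace b :: ('k, 'a, 'n::finite) rep_poly)
    \<in> trace_reps scale"
proof -
  let ?lin = "lin_ext (\<lambda>c f. poly_const c * f)"
  let ?tr = "?lin (\<lambda>xs. poly_trace (xs ! 0 * xs ! 1)) (dbr_rep a b) :: ('k, 'a, 'n) rep_poly"
  have "poly_trace (x * y) - (\<Sum>i\<in>UNIV. \<Sum>k\<in>UNIV. poly_var x i k * poly_var y k (i :: 'n)) \<in> rep_ideal scale" for x y
    unfolding poly_trace_def sum_subtractf[symmetric]
    by (rule rep_poly.subspace_sum[OF subspace_rep_ideal]) (rule product_relation)
  then have "?lin (\<lambda>xs. poly_trace (xs ! 0 * xs ! 1)
      - (\<Sum>i\<in>UNIV. \<Sum>k\<in>UNIV. poly_var (xs ! 0) i k * poly_var (xs ! 1) k (i :: 'n))) (dbr_rep a b) \<in> rep_ideal scale"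
    by (intro rep_poly.lin_ext_in_subspace[OF subspace_rep_ideal])
  moreover have "poly_bracket coord_bracket (poly_trace a) (poly_trace b)
      = ?lin (\<lambda>xs. \<Sum>i\<in>UNIV. \<Sum>k\<in>UNIV. poly_var (xs ! 0) i k * poly_var (xs ! 1) k (i :: 'n)) (dbr_rep a b)"
    by (simp add: poly_trace_def poly_bracket_sum_left poly_bracket_sum_right poly_bracket_var
        coord_bracket_simp evaluate_2_def rep_poly.lin_ext_fun_sum) (rule sum.swap)
  ultimately have "?tr - poly_bracket coord_bracket (poly_trace a) (poly_trace b) \<in> rep_ideal scale"
    by (simp add: rep_poly.lin_ext_fun_diff)
  moreover have "?tr \<in> trace_reps scale"
    by (rule rep_poly.lin_ext_in_subspace[OF subspace_trace_reps]) (rule trace_reps_trace)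
  ultimately show ?thesis using trace_reps_cong by blast
qed

lemma tensor_lift_coord:
  "tensor_lift (rep_algebra scale)
      (\<lambda>xs. rep_coord scale (xs ! 0) i l \<otimes>\<^bsub>rep_algebra scale\<^esub> rep_coord scale (xs ! 1) k j) (dbr a b)
    = rep_class scale (coord_bracket (a, i, j) (b, k, l :: 'n::finite))"
  unfolding rep_coord_eq rep_mult coord_bracket_simp evaluate_2_def dbr_rep_class[symmetric, of a b]
  by (rule rep.tensor_lift_class[OF evaluate_2_multilinear]) simp

end

section \<open>The Poisson bracket of a double Poisson bracket\<close>

theorem theorem4p8:
  fixes scale :: "'k::field_char_0 \<Rightarrow> 'a::{ring, monoid_mult} \<Rightarrow> 'a"
    and dbr :: "'a \<Rightarrow> 'a \<Rightarrow> ('a list \<Rightarrow>\<^sub>0 'k) set"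
  assumes "k_algebra scale"
    and "finitely_generated_algebra scale"
    and "double_poisson_bracket scale dbr"
  shows "(\<exists>!br :: ('k, 'a, 'n::finite) rep_poly set \<Rightarrow> ('k, 'a, 'n) rep_poly set
            \<Rightarrow> ('k, 'a, 'n) rep_poly set. induced_biderivation scale dbr br) \<and>
    (\<forall>br :: ('k, 'a, 'n) rep_poly set \<Rightarrow> ('k, 'a, 'n) rep_poly set
            \<Rightarrow> ('k, 'a, 'n) rep_poly set.
          induced_biderivation scale dbr br \<longrightarrow>
            poisson_bracket (rep_algebra scale) br \<and> poisson_bracket (trace_algebra scale) br)"
proof -
  interpret k_algebra scale by (rule assms(1))
  interpret double_poisson_algebra scale dbr
    by unfold_locales (use assms(3) in \<open>auto simp: double_poisson_bracket_def\<close>)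
  interpret rep_bracket scale "coord_bracket :: 'a \<times> 'n \<times> 'n \<Rightarrow> _" by (rule rep_bracket_coord)
  have "induced_bracket (rep_coord scale a i j) (rep_coord scale b k l)
      = rep_class scale (coord_bracket (a, i, j) (b, k, l))" for a b i j k l
    by (simp add: rep_coord_eq induced_bracket_class poly_bracket_var)
  then have "induced_biderivation scale dbr induced_bracket"
    unfolding induced_biderivation_def Let_def tensor_lift_coord
    using induced_bracket_extensional poisson_induced_bracket by (simp add: poisson_bracket_def)
  moreover have "br = induced_bracket" if "induced_biderivation scale dbr br" for br
    using that unfolding induced_biderivation_def Let_def tensor_lift_coord
    by (intro biderivation_unique) blast+
  ultimately show ?thesis
    using poisson_induced_bracket poisson_trace[OF bracket_of_traces] by blast
qed

end
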